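(* Consider the plant $\dot x=Ax+Bu+Ep(q)+E_ww$, $y=Cx$, $q=C_qx$ (i.e. $D=\mathbf 0$, $F_w=\mathbf 0$), where $p$ is globally Lipschitz continuous and the disturbance satisfies $\|w\|_\infty\le\omega_0$ for an arbitrary given $\omega_0>0$. Suppose there exist $\alpha_0>0$, $\mu>0$, a symmetric $P>0$ in $\mathbb{R}^{2n_x\times2n_x}$ and matrices $K_1,K_2,L_1,L_2$ such that, for the continuous-time closed-loop system formed by the plant, the observer $\dot{\hat x}=A\hat x+Bu+Ep(\hat q+L_1(\hat y-y))+L_2(\hat y-y)$, $\hat y=C\hat x$, $\hat q=C_q\hat x$, and the controller $u=K_1\hat x+K_2p(C_q\hat x)$, the function $V(z)=z^\top Pz$ with $z=(x^\top,(x-\hat x)^\top)^\top$ satisfies $\dot V\le-\alpha_0V$ along its trajectories when $w\equiv0$. Now consider the implementation with two asynchronous event-triggering mechanisms: output sampling times $t_0^y=0<t_1^y<\cdots$ with $y_s(t)=y(t_k^y)$ for $t\in[t_k^y,t_{k+1}^y)$ and $t_{k+1}^y=\inf\{t\mid t\ge t_k^y+\tau_y,\ \|y_s(t)-y(t)\|>\sigma_y\|y(t)\|+\epsilon_y\}$; observer $\dot{\hat x}=A\hat x+Bu+Ep(\hat q+L_1(\hat y-y_s))+L_2(\hat y-y_s)$, $\hat y=C\hat x$, $\hat q=C_q\hat x$; controller update times $t_0^u=0<t_1^u<\cdots$ with $\hat x_s(t)=\hat x(t_k^u)$ for $t\in[t_k^u,t_{k+1}^u)$, $t_{k+1}^u=\inf\{t\mid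 t\ge t_k^u+\tau_u,\ \|\hat x_s(t)-\hat x(t)\|>\sigma_u\|\hat x(t)\|+\epsilon_u\}$, and input $u(t)=K_1\hat x_s(t)+K_2p(C_q\hat x_s(t))$. Then positive numbers $\tau_y,\sigma_y,\epsilon_y,\tau_u,\sigma_u,\epsilon_u$ can be chosen such that this event-triggered closed-loop system is input-to-state practically stable with respect to $w$.
   Context: Plant: $x\in\mathbb{R}^{n_x}$ state, $u\in\mathbb{R}^{n_u}$ input, $y\in\mathbb{R}^{n_y}$ output, $w\in\mathbb{R}^{n_w}$ unknown measurable disturbance; $A,B,C,C_q,E,E_w$ constant real matrices of compatible sizes; $p:\mathbb{R}^{n_q}\to\mathbb{R}^{n_p}$ known with $p(0)=0$. The closed loop is input-to-state practically stable (ISpS) w.r.t. $w$ if there exist $\beta_1\in\mathcal{KL}$, $\beta_2\in\mathcal K$ and a constant $d\ge0$ such that for every initial condition $(x(0),\hat x(0))$ and every admissible disturbance $w$, $\|z(t)\|\le\beta_1(\|z(0)\|,t)+\beta_2(\|w\|_\infty)+d$ for all $t\ge0$, where $z=(x^\top,(x-\hat x)^\top)^\top$ and $\|w\|_\infty=\sup_{t\ge0}\|w(t)\|$. *)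

theory Defs
  imports "HOL-Analysis.Analysis"
begin

text \<open>Comparison function classes (Khalil's convention).\<close>

definition class_K :: "(real \<Rightarrow> real) \<Rightarrow> bool" where
  "class_K \<alpha> \<longleftrightarrow> continuous_on {0..} \<alpha> \<and> strict_mono_on {0..} \<alpha> \<and> \<alpha> 0 = 0"

definition class_KL :: "(real \<Rightarrow> real \<Rightarrow> real) \<Rightarrow> bool" where
  "class_KL \<beta> \<longleftrightarrow>
     continuous_on ({0..} \<times> {0..}) (\<lambda>(r, s). \<beta> r s) \<and>
     (\<forall>s\<ge>0. class_K (\<lambda>r. \<beta> r s)) \<and>
     (\<forall>r\<ge>0. antimono_on {0..} (\<lambda>s. \<beta> r s) \<and> ((\<lambda>s. \<beta> r s) \<longlongrightarrow> 0) at_top)"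

text \<open>Stacking of two vectors of R^{n_x} into a vector of R^{2 n_x}.\<close>

definition stack :: "real^'n \<Rightarrow> real^'n \<Rightarrow> real^('n + 'n)" where
  "stack a b = (\<chi> i. case i of Inl j \<Rightarrow> a $ j | Inr j \<Rightarrow> b $ j)"

text \<open>Solutions (Caratheodory sense, on [0,oo)) of the closed loop with two asynchronous
  event-triggering mechanisms. Sampling times are extended reals; an infimum over an empty
  set is +oo, meaning no further event occurs.\<close>

definition etm_solution ::
  "real^'x^'x \<Rightarrow> real^'u^'x \<Rightarrow> real^'x^'y \<Rightarrow> real^'x^'q \<Rightarrow> real^'p^'x \<Rightarrow> real^'w^'x \<Rightarrow>
   (real^'q \<Rightarrow> real^'p) \<Rightarrow> real^'x^'u \<Rightarrow> real^'p^'u \<Rightarrow> real^'y^'q \<Rightarrow> real^'y^'x \<Rightarrow>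
   real \<Rightarrow> real \<Rightarrow> real \<Rightarrow> real \<Rightarrow> real \<Rightarrow> real \<Rightarrow>
   (real \<Rightarrow> real^'w) \<Rightarrow> (real \<Rightarrow> real^'x) \<Rightarrow> (real \<Rightarrow> real^'x) \<Rightarrow>
   (nat \<Rightarrow> ereal) \<Rightarrow> (nat \<Rightarrow> ereal) \<Rightarrow> (real \<Rightarrow> real^'y) \<Rightarrow> (real \<Rightarrow> real^'x) \<Rightarrow> bool" where
  "etm_solution A B C Cq E Ew p K1 K2 L1 L2 \<tau>y \<sigma>y \<epsilon>y \<tau>u \<sigma>u \<epsilon>u w x xh ty tu ys xhs \<longleftrightarrow>
     ty 0 = 0 \<and> tu 0 = 0 \<and>
     (\<forall>k. ty (Suc k) = Inf {ereal t | t. ty k + ereal \<tau>y \<le> ereal t \<and>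
          norm (C *v x (real_of_ereal (ty k)) - C *v x t) > \<sigma>y * norm (C *v x t) + \<epsilon>y}) \<and>
     (\<forall>k. tu (Suc k) = Inf {ereal t | t. tu k + ereal \<tau>u \<le> ereal t \<and>
          norm (xh (real_of_ereal (tu k)) - xh t) > \<sigma>u * norm (xh t) + \<epsilon>u}) \<and>
     (\<forall>k t. ty k \<le> ereal t \<and> ereal t < ty (Suc k) \<longrightarrow> ys t = C *v x (real_of_ereal (ty k))) \<and>
     (\<forall>k t. tu k \<le> ereal t \<and> ereal t < tu (Suc k) \<longrightarrow> xhs t = xh (real_of_ereal (tu k))) \<and>
     (\<forall>t\<ge>0. ((\<lambda>s. A *v x s + B *v (K1 *v xhs s + K2 *v p (Cq *v xhs s))
                  + E *v p (Cq *v x s) + Ew *v w s) has_integral (x t - x 0)) {0..t}) \<and>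
     (\<forall>t\<ge>0. ((\<lambda>s. A *v xh s + B *v (K1 *v xhs s + K2 *v p (Cq *v xhs s))
                  + E *v p (Cq *v xh s + L1 *v (C *v xh s - ys s))
                  + L2 *v (C *v xh s - ys s)) has_integral (xh t - xh 0)) {0..t})"

end

theory Submission
  imports Defs "HOL-Real_Asymp.Real_Asymp"
begin

text \<open>In the coordinates \<open>z = (x, x - x\<^sub>h)\<close> the event-triggered loop is the nominal loop perturbed by
  the sampling errors \<open>x\<^sub>s - x\<^sub>h\<close> and \<open>y\<^sub>s - y\<close> and by \<open>w\<close>. A held sample is either younger
  than \<open>\<tau>\<close>, so that its error is at most \<open>\<tau>\<close> times a bound on \<open>z'\<close> over a window of length \<open>2\<tau>\<close>,
  or it still satisfies the trigger threshold \<open>\<sigma> \<parallel>\<cdot>\<parallel> + \<epsilon>\<close>. Hence, whenever \<open>V z = z\<^sup>T P z\<close> stays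
  below \<open>G\<close> on that window, the increments of \<open>V\<close> obey
  \<open>V(t) - V(t - s) \<le> s (-\<alpha> V(t - s) + b G + c) + O(s\<^sup>2)\<close> with \<open>b\<close> proportional to \<open>\<tau> + \<sigma>\<close>.
  For \<open>\<tau> = \<sigma>\<close> small, a Halanay-type comparison with the delayed supremum yields
  \<open>V(z t) \<le> k \<parallel>z 0\<parallel>\<^sup>2 exp (-\<alpha> t / 2) + D\<close>, which is an ISpS estimate. Working with increments
  avoids differentiating \<open>V\<close> along solutions that are only absolutely continuous.\<close>

section \<open>Stacked coordinates\<close>

lemma stack_nth_Inl [simp]: "stack a b $ Inl i = a $ i"
  and stack_nth_Inr [simp]: "stack a b $ Inr i = b $ i"
  by (simp_all add: stack_def)

lemma inner_stack: "stack a b \<bullet> stack c d = a \<bullet> c + b \<bullet> d"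
proof -
  have "stack a b \<bullet> stack c d = (\<Sum>i\<in>range Inl \<union> range Inr. stack a b $ i * stack c d $ i)"
    by (simp add: inner_vec_def UNIV_sum)
  also have "\<dots> = (\<Sum>i\<in>range Inl. stack a b $ i * stack c d $ i)
      + (\<Sum>i\<in>range Inr. stack a b $ i * stack c d $ i)"
    by (rule sum.union_disjoint) auto
  also have "\<dots> = a \<bullet> c + b \<bullet> d"
    by (simp add: sum.reindex inner_vec_def)
  finally show ?thesis .
qed

lemma stack_diff: "stack (a - b) (c - d) = stack a c - stack b d"
  by (simp add: vec_eq_iff stack_def split: sum.split)

lemma norm_stack_squared: "norm (stack a b) ^ 2 = norm a ^ 2 + norm b ^ 2"
  by (simp add: power2_norm_eq_inner inner_stack)

lemma norm_le_norm_stack1: "norm a \<le> norm (stack a b)"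
  and norm_le_norm_stack2: "norm b \<le> norm (stack a b)"
  by (auto intro: power2_le_imp_le simp: norm_stack_squared)

lemma norm_stack_le: "norm (stack a b) \<le> norm a + norm b"
  by (rule power2_le_imp_le) (simp_all add: norm_stack_squared power2_sum)

lemma norm_le_twice_norm_stack_diff: "norm b \<le> 2 * norm (stack a (a - b))"
  using norm_triangle_ineq4[of a "a - b"] norm_le_norm_stack1[of a "a - b"]
    norm_le_norm_stack2[of "a - b" a]
  by simp

lemma has_integral_stack:
  assumes "(f has_integral i) S" and "(g has_integral j) S"
  shows "((\<lambda>s. stack (f s) (g s)) has_integral stack i j) S"
proof -
  have linear: "bounded_linear (\<lambda>a. stack a 0)" "bounded_linear (\<lambda>b. stack 0 b)"
    by (auto intro!: linear_conv_bounded_linear[THEN iffD1] linearI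
        simp: vec_eq_iff stack_def split: sum.split)
  have split: "stack a b = stack a 0 + stack 0 b" for a b
    by (simp add: vec_eq_iff stack_def split: sum.split)
  show ?thesis
    using has_integral_add[OF has_integral_linear[OF assms(1) linear(1)]
        has_integral_linear[OF assms(2) linear(2)]]
    by (subst (1 2) split) (simp add: o_def)
qed

section \<open>Event-triggered sampling\<close>

text \<open>This is all that the proof uses of the triggering rules.\<close>

definition etm_held :: "(real \<Rightarrow> 'a::real_normed_vector) \<Rightarrow> (real \<Rightarrow> 'a) \<Rightarrow> real \<Rightarrow> real \<Rightarrow> real \<Rightarrow> bool"
  where "etm_held g h \<tau> \<sigma> \<epsilon> \<longleftrightarrow>
    (\<forall>q\<ge>0. \<exists>r\<in>{0..q}. h q = g r \<and> (q - r < \<tau> \<or> norm (g r - g q) \<le> \<sigma> * norm (g q) + \<epsilon>))"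

lemma event_time_lower_bound:
  assumes "tk 0 = 0" and "\<And>k. tk k + ereal \<tau> \<le> tk (Suc k)"
  shows "ereal (real k * \<tau>) \<le> tk k"
proof (induction k)
  case (Suc k)
  have "ereal (real (Suc k) * \<tau>) = ereal (real k * \<tau>) + ereal \<tau>"
    by (simp add: algebra_simps)
  also have "\<dots> \<le> tk k + ereal \<tau>"
    using Suc by (rule add_right_mono)
  also have "\<dots> \<le> tk (Suc k)"
    by (rule assms(2))
  finally show ?case .
qed (simp add: assms(1))

lemma last_event_before:
  assumes "tk 0 = 0" and "\<And>k. tk k + ereal \<tau> \<le> tk (Suc k)" and "0 < \<tau>" and "0 \<le> q"
  obtains k r where "tk k = ereal r" "0 \<le> r" "r \<le> q" "ereal q < tk (Suc k)"
proof -
  define N where "N = {k. tk k \<le> ereal q}"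
  have "N \<subseteq> {..nat \<lceil>q / \<tau>\<rceil>}"
  proof
    fix k assume "k \<in> N"
    then have "ereal (real k * \<tau>) \<le> ereal q"
      using event_time_lower_bound[of tk \<tau> k, OF assms(1,2)] unfolding N_def
      by (metis mem_Collect_eq order_trans)
    then have "real k \<le> q / \<tau>"
      using \<open>0 < \<tau>\<close> by (simp add: field_simps)
    then show "k \<in> {..nat \<lceil>q / \<tau>\<rceil>}"
      by (simp add: nat_le_iff le_ceiling_iff) linarith
  qed
  then have "finite N"
    by (rule finite_subset) simp
  moreover have "0 \<in> N"
    using assms(1,4) by (simp add: N_def)
  ultimately have "Max N \<in> N" "Suc (Max N) \<notin> N"
    by (auto intro: Max_in dest: Max_ge)
  moreover have "0 \<le> tk (Max N)"
    using event_time_lower_bound[of tk \<tau> "Max N", OF assms(1,2)] \<open>0 < \<tau>\<close>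
    by (metis order_trans ereal_less_eq(5) of_nat_0_le_iff zero_le_mult_iff less_imp_le)
  ultimately show ?thesis
    using that[of "Max N" "real_of_ereal (tk (Max N))"]
    by (cases "tk (Max N)") (auto simp: N_def)
qed

lemma etm_held_if_event_triggered:
  fixes g h :: "real \<Rightarrow> 'a::real_normed_vector"
  assumes t0: "tk 0 = 0" and "0 < \<tau>"
    and next_event: "\<forall>k. tk (Suc k) = Inf {ereal t | t. tk k + ereal \<tau> \<le> ereal t \<and>
          norm (g (real_of_ereal (tk k)) - g t) > \<sigma> * norm (g t) + \<epsilon>}"
    and hold: "\<forall>k t. tk k \<le> ereal t \<and> ereal t < tk (Suc k) \<longrightarrow> h t = g (real_of_ereal (tk k))"
  shows "etm_held g h \<tau> \<sigma> \<epsilon>"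
  unfolding etm_held_def
proof (intro allI impI)
  fix q :: real
  assume "0 \<le> q"
  have dwell: "tk k + ereal \<tau> \<le> tk (Suc k)" for k
    unfolding next_event[rule_format] by (rule Inf_greatest) auto
  obtain k r where r: "tk k = ereal r" "0 \<le> r" "r \<le> q" "ereal q < tk (Suc k)"
    using last_event_before[of tk \<tau> q, OF t0 dwell \<open>0 < \<tau>\<close> \<open>0 \<le> q\<close>] .
  have "\<not> (\<tau> \<le> q - r \<and> norm (g r - g q) > \<sigma> * norm (g q) + \<epsilon>)"
  proof
    assume "\<tau> \<le> q - r \<and> norm (g r - g q) > \<sigma> * norm (g q) + \<epsilon>"
    then have "tk (Suc k) \<le> ereal q"
      unfolding next_event[rule_format] using r(1) by (intro Inf_lower) auto
    with r(4) show False
      by simp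
  qed
  moreover have "h q = g r"
    using hold[rule_format, of k q] r by simp
  ultimately show "\<exists>r\<in>{0..q}. h q = g r \<and> (q - r < \<tau> \<or> norm (g r - g q) \<le> \<sigma> * norm (g q) + \<epsilon>)"
    using r(2,3) by (intro bexI[of _ r]) auto
qed

lemma etm_held_norm_le:
  assumes "etm_held g h \<tau> \<sigma> \<epsilon>" and "0 \<le> q" and "0 \<le> \<tau>" and "0 \<le> \<sigma>" and "0 \<le> \<epsilon>"
    and window: "\<And>r. max 0 (q - \<tau>) \<le> r \<Longrightarrow> r \<le> q \<Longrightarrow> norm (g r) \<le> M"
  shows "norm (h q) \<le> (1 + \<sigma>) * M + \<epsilon>"
proof -
  obtain r where r: "r \<in> {0..q}" "h q = g r"
    and trigger: "q - r < \<tau> \<or> norm (g r - g q) \<le> \<sigma> * norm (g q) + \<epsilon>"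
    using assms(1,2) unfolding etm_held_def by blast
  have "norm (g q) \<le> M"
    using window assms(2,3) by simp
  moreover from this have "0 \<le> M"
    by (rule order_trans[OF norm_ge_zero])
  ultimately have "0 \<le> \<sigma> * M" "\<sigma> * norm (g q) \<le> \<sigma> * M"
    using \<open>0 \<le> \<sigma>\<close> by (simp_all add: mult_left_mono)
  show ?thesis
  proof (cases "q - r < \<tau>")
    case True
    then have "norm (g r) \<le> M"
      using window r(1) by auto
    with r(2) \<open>0 \<le> \<sigma> * M\<close> \<open>0 \<le> \<epsilon>\<close> show ?thesis
      by (simp add: algebra_simps)
  next
    case False
    with trigger norm_triangle_ineq2[of "g r" "g q"] have "norm (g r) \<le> norm (g q) + \<sigma> * norm (g q) + \<epsilon>"
      by simp
    with r(2) \<open>norm (g q) \<le> M\<close> \<open>\<sigma> * norm (g q) \<le> \<sigma> * M\<close> show ?thesis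
      by (simp add: algebra_simps)
  qed
qed

lemma etm_held_error_le:
  assumes "etm_held g h \<tau> \<sigma> \<epsilon>" and "0 \<le> q" and "0 \<le> \<tau>" and "0 \<le> \<sigma>" and "0 \<le> \<epsilon>"
    and "norm (g q) \<le> M"
    and window: "\<And>r. max 0 (q - \<tau>) \<le> r \<Longrightarrow> r \<le> q \<Longrightarrow> norm (g r - g q) \<le> \<delta>"
  shows "norm (h q - g q) \<le> \<delta> + \<sigma> * M + \<epsilon>"
proof -
  obtain r where r: "r \<in> {0..q}" "h q = g r"
    and trigger: "q - r < \<tau> \<or> norm (g r - g q) \<le> \<sigma> * norm (g q) + \<epsilon>"
    using assms(1,2) unfolding etm_held_def by blast
  have "0 \<le> \<delta>"
    using window[of q] assms(2,3) by simp
  have "0 \<le> M"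
    using norm_ge_zero \<open>norm (g q) \<le> M\<close> by (rule order_trans)
  then have "0 \<le> \<sigma> * M" "\<sigma> * norm (g q) \<le> \<sigma> * M"
    using \<open>0 \<le> \<sigma>\<close> \<open>norm (g q) \<le> M\<close> by (simp_all add: mult_left_mono)
  show ?thesis
  proof (cases "q - r < \<tau>")
    case True
    then have "norm (g r - g q) \<le> \<delta>"
      using window r(1) by auto
    with r(2) \<open>0 \<le> \<sigma> * M\<close> \<open>0 \<le> \<epsilon>\<close> show ?thesis
      by simp
  next
    case False
    with trigger r(2) \<open>0 \<le> \<delta>\<close> \<open>\<sigma> * norm (g q) \<le> \<sigma> * M\<close> show ?thesis
      by simp
  qed
qed

section \<open>A Halanay-type inequality\<close>

lemma first_crossing:
  fixes f :: "real \<Rightarrow> real"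
  assumes cont: "continuous_on {a..b} f" and "f a < 0" and "0 \<le> f b" and "a \<le> b"
  obtains c where "a < c" "c \<le> b" "f c = 0" "\<And>x. a \<le> x \<Longrightarrow> x < c \<Longrightarrow> f x < 0"
proof -
  define S where "S = {x \<in> {a..b}. 0 \<le> f x}"
  have "closed S"
    unfolding S_def by (intro continuous_on_closed_Collect_le cont continuous_on_const) simp
  moreover have "b \<in> S" "bdd_below S"
    using assms(3,4) by (auto simp: S_def intro: bdd_belowI[of _ a])
  ultimately have "Inf S \<in> S"
    by (intro closed_contains_Inf) auto
  define c where "c = Inf S"
  have below: "f x < 0" if "a \<le> x" "x < c" for x
  proof (rule ccontr)
    assume "\<not> f x < 0"
    then have "x \<in> S"
      using that \<open>Inf S \<in> S\<close> by (auto simp: S_def c_def)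
    then have "c \<le> x"
      unfolding c_def using \<open>bdd_below S\<close> by (rule cInf_lower)
    with that show False
      by simp
  qed
  have "c \<in> {a..b}" "0 \<le> f c"
    using \<open>Inf S \<in> S\<close> by (auto simp: S_def c_def)
  moreover from this have "a < c"
    using \<open>f a < 0\<close> by (metis atLeastAtMost_iff not_le order.order_iff_strict)
  moreover have "f c \<le> 0"
  proof (rule continuous_le_on_closure[where S = "{a..<c}" and f = f and x = c])
    show "continuous_on (closure {a..<c}) f"
      using \<open>a < c\<close> \<open>c \<in> {a..b}\<close> by (auto intro: continuous_on_subset[OF cont])
    show "c \<in> closure {a..<c}"
      using \<open>a < c\<close> by simp
  qed (use below in \<open>auto intro: less_imp_le\<close>)
  ultimately show ?thesis
    using that[of c] below by auto
qed

lemma exp_decay_increment_ge: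
  fixes K \<gamma> s t :: real
  assumes "0 \<le> K"
  shows "- (K * \<gamma> * exp (- \<gamma> * t)) * (s * exp (\<gamma> * s)) \<le> K * exp (- \<gamma> * t) - K * exp (- \<gamma> * (t - s))"
proof -
  have "(1 - \<gamma> * s) * exp (\<gamma> * s) \<le> exp (- (\<gamma> * s)) * exp (\<gamma> * s)"
    using exp_ge_add_one_self[of "- (\<gamma> * s)"] by (intro mult_right_mono) simp_all
  then have "exp (\<gamma> * s) - 1 \<le> \<gamma> * s * exp (\<gamma> * s)"
    by (simp add: exp_minus field_simps)
  then have "K * exp (- \<gamma> * t) * (exp (\<gamma> * s) - 1) \<le> K * exp (- \<gamma> * t) * (\<gamma> * s * exp (\<gamma> * s))"
    using assms by (intro mult_left_mono) simp_all
  moreover have "exp (- \<gamma> * (t - s)) = exp (- \<gamma> * t) * exp (\<gamma> * s)"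
    by (simp add: algebra_simps flip: exp_add)
  ultimately show ?thesis
    by (simp add: algebra_simps)
qed

lemma halanay_first_crossing:
  fixes u :: "real \<Rightarrow> real" and K \<gamma> D :: real
  defines "g \<equiv> \<lambda>t. K * exp (- \<gamma> * t) + D"
  assumes cont: "continuous_on {0..ts} u" and "0 < ts" and "0 < \<gamma>" and "0 \<le> T" and "0 \<le> K" and "0 \<le> D"
    and "0 < \<eta>" and at_ts: "u ts = g ts + \<eta>" and before_ts: "\<And>q. 0 \<le> q \<Longrightarrow> q < ts \<Longrightarrow> u q < g q + \<eta>"
    and step: "\<And>t s G. 0 < s \<Longrightarrow> s \<le> t \<Longrightarrow> 0 \<le> G \<Longrightarrow>
        (\<And>q. max 0 (t - s - T) \<le> q \<Longrightarrow> q \<le> t \<Longrightarrow> u q \<le> G) \<Longrightarrow>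
        u t - u (t - s) \<le> s * (- a * u (t - s) + b * G + c) + s\<^sup>2 * (q1 * G + q0)"
  shows "0 \<le> - a * u ts + b * (g (ts - T) + \<eta>) + c + K * \<gamma> * exp (- \<gamma> * ts)"
proof -
  define G where "G s = g (ts - s - T) + \<eta>" for s
  define \<phi> where "\<phi> s = - a * u (ts - s)
    + (b * G s + c + s * (q1 * G s + q0) + K * \<gamma> * exp (- \<gamma> * ts) * exp (\<gamma> * s))" for s
  have "0 \<le> \<phi> s" if "0 < s" "s \<le> ts" for s
  proof -
    have "g q' \<le> g q" if "q \<le> q'" for q q'
      unfolding g_def using that \<open>0 < \<gamma>\<close> \<open>0 \<le> K\<close> by (auto intro!: mult_left_mono)
    then have "u q \<le> G s" if "max 0 (ts - s - T) \<le> q" "q \<le> ts" for q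
      using before_ts[of q] at_ts that \<open>0 < s\<close> \<open>0 \<le> T\<close> by (cases "q < ts") (force simp: G_def)+
    moreover have "0 \<le> G s"
      using \<open>0 < \<eta>\<close> \<open>0 \<le> K\<close> \<open>0 \<le> D\<close> by (simp add: G_def g_def)
    ultimately have "u ts - u (ts - s) \<le> s * (- a * u (ts - s) + b * G s + c) + s\<^sup>2 * (q1 * G s + q0)"
      using step that by blast
    moreover have "- (K * \<gamma> * exp (- \<gamma> * ts)) * (s * exp (\<gamma> * s)) \<le> u ts - u (ts - s)"
      using exp_decay_increment_ge[OF \<open>0 \<le> K\<close>, of \<gamma> ts s] at_ts before_ts[of "ts - s"] that
      by (simp add: g_def)
    ultimately have "s * (- K * \<gamma> * exp (- \<gamma> * ts) * exp (\<gamma> * s))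
        \<le> s * (- a * u (ts - s) + b * G s + c + s * (q1 * G s + q0))"
      by (simp add: power2_eq_square algebra_simps)
    then have "- K * \<gamma> * exp (- \<gamma> * ts) * exp (\<gamma> * s) \<le> - a * u (ts - s) + b * G s + c + s * (q1 * G s + q0)"
      using \<open>0 < s\<close> by (simp only: mult_le_cancel_left_pos)
    then show ?thesis
      by (simp add: \<phi>_def algebra_simps)
  qed
  moreover have "continuous_on {0..ts} \<phi>"
    unfolding \<phi>_def
  proof (rule continuous_on_add[OF continuous_on_mult_left])
    show "continuous_on {0..ts} (\<lambda>s. u (ts - s))"
      by (rule continuous_on_compose2[OF cont]) (auto intro!: continuous_intros)
    show "continuous_on {0..ts}
        (\<lambda>s. b * G s + c + s * (q1 * G s + q0) + K * \<gamma> * exp (- \<gamma> * ts) * exp (\<gamma> * s))"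
      unfolding G_def g_def by (intro continuous_intros)
  qed
  ultimately have "0 \<le> \<phi> 0"
    using \<open>0 < ts\<close> continuous_ge_on_closure[where S = "{0<..ts}" and f = \<phi> and x = 0 and a = 0] by auto
  then show ?thesis
    by (simp add: \<phi>_def G_def)
qed

lemma halanay_inequality:
  fixes u :: "real \<Rightarrow> real"
  assumes cont: "\<And>T. continuous_on {0..T} u"
    and "0 < \<gamma>" and "0 \<le> b" and "0 \<le> T" and "0 \<le> K" and "0 \<le> D"
    and rate: "\<gamma> + b * exp (\<gamma> * T) \<le> a" and offset: "c < (a - b) * D"
    and init: "u 0 \<le> K + D"
    and step: "\<And>t s G. 0 < s \<Longrightarrow> s \<le> t \<Longrightarrow> 0 \<le> G \<Longrightarrow>
        (\<And>q. max 0 (t - s - T) \<le> q \<Longrightarrow> q \<le> t \<Longrightarrow> u q \<le> G) \<Longrightarrow>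
        u t - u (t - s) \<le> s * (- a * u (t - s) + b * G + c) + s\<^sup>2 * (q1 * G + q0)"
    and "0 \<le> t"
  shows "u t \<le> K * exp (- \<gamma> * t) + D"
proof (rule ccontr)
  define g where "g t = K * exp (- \<gamma> * t) + D" for t
  assume "\<not> u t \<le> K * exp (- \<gamma> * t) + D"
  then obtain \<eta> where "0 < \<eta>" "u t = g t + \<eta>"
    by (intro that[of "u t - g t"]) (auto simp: g_def)
  moreover have "continuous_on {0..t} (\<lambda>q. u q - (g q + \<eta>))"
    unfolding g_def by (intro continuous_intros cont)
  ultimately obtain ts where "0 < ts" and at_ts: "u ts = g ts + \<eta>"
    and before_ts: "\<And>q. 0 \<le> q \<Longrightarrow> q < ts \<Longrightarrow> u q < g q + \<eta>"
    using first_crossing[of 0 t "\<lambda>q. u q - (g q + \<eta>)"] init \<open>0 \<le> t\<close> by (auto simp: g_def)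
  have "0 \<le> - a * u ts + b * (g (ts - T) + \<eta>) + c + K * \<gamma> * exp (- \<gamma> * ts)"
    using cont \<open>0 < ts\<close> assms(2,4-6) \<open>0 < \<eta>\<close> at_ts before_ts step
    unfolding g_def by (rule halanay_first_crossing)
  then have "0 \<le> K * exp (- \<gamma> * ts) * (\<gamma> + b * exp (\<gamma> * T) - a) + (b - a) * \<eta> + (c - (a - b) * D)"
    using at_ts by (simp add: g_def algebra_simps flip: exp_add)
  moreover have "K * exp (- \<gamma> * ts) * (\<gamma> + b * exp (\<gamma> * T) - a) \<le> 0"
    using rate \<open>0 \<le> K\<close> by (intro mult_nonneg_nonpos) auto
  moreover have "1 \<le> exp (\<gamma> * T)"
    using \<open>0 < \<gamma>\<close> \<open>0 \<le> T\<close> by simp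
  then have "b < a"
    using rate \<open>0 < \<gamma>\<close> mult_left_mono[of 1 "exp (\<gamma> * T)" b] \<open>0 \<le> b\<close> by simp
  then have "(b - a) * \<eta> < 0"
    using \<open>0 < \<eta>\<close> by (simp add: mult_neg_pos)
  ultimately show False
    using offset by linarith
qed

section \<open>Quadratic Lyapunov functions along integral curves\<close>

lemma has_integral_subinterval_of_primitive:
  fixes f :: "real \<Rightarrow> 'a::banach"
  assumes primitive: "\<And>t. 0 \<le> t \<Longrightarrow> (f has_integral (X t - X 0)) {0..t}" and "0 \<le> a" and "a \<le> b"
  shows "(f has_integral (X b - X a)) {a..b}"
proof -
  have "f integrable_on {0..b}"
    using primitive[of b] assms(2,3) by (auto simp: has_integral_integrable)
  then have "integral {0..a} f + integral {a..b} f = integral {0..b} f"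
    using Henstock_Kurzweil_Integration.integral_combine[OF assms(2,3)] by blast
  moreover have "integral {0..a} f = X a - X 0" "integral {0..b} f = X b - X 0"
    using primitive[of a] primitive[of b] assms(2,3) by (simp_all add: integral_unique)
  moreover have "f integrable_on {a..b}"
    using \<open>f integrable_on {0..b}\<close> by (rule integrable_subinterval_real) (use assms(2) in auto)
  ultimately show ?thesis
    by (metis has_integral_integrable_integral add_diff_cancel_left' diff_diff_eq2 eq_diff_eq)
qed

lemma norm_diff_le_integral_bound:
  fixes f :: "real \<Rightarrow> 'a::banach"
  assumes increments: "\<And>a b. lo \<le> a \<Longrightarrow> a \<le> b \<Longrightarrow> b \<le> hi \<Longrightarrow> (f has_integral (X b - X a)) {a..b}"
    and bound: "\<And>r. lo \<le> r \<Longrightarrow> r \<le> hi \<Longrightarrow> norm (f r) \<le> M"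
    and "r1 \<in> {lo..hi}" and "r2 \<in> {lo..hi}"
  shows "norm (X r1 - X r2) \<le> \<bar>r1 - r2\<bar> * M"
proof -
  have "norm (X b - X a) \<le> (b - a) * M" if "a \<in> {lo..hi}" "b \<in> {lo..hi}" "a \<le> b" for a b
    using has_integral_bound_real[of M "{}" f "X b - X a" a b] increments[of a b] bound that
    by (auto simp: mult.commute order_trans[OF norm_ge_zero bound[of a]])
  from this[of r2 r1] this[of r1 r2] assms(3,4) show ?thesis
    by (cases "r2 \<le> r1") (auto simp: norm_minus_commute)
qed

lemma has_integral_le_const_real:
  fixes f :: "real \<Rightarrow> real"
  assumes "(f has_integral i) {a..b}" and "a \<le> b" and "\<And>x. x \<in> {a..b} \<Longrightarrow> f x \<le> c"
  shows "i \<le> (b - a) * c"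
proof -
  have "((\<lambda>x. c) has_integral (b - a) * c) {a..b}"
    using has_integral_const_real[of c a b] \<open>a \<le> b\<close> by simp
  from assms(1) this assms(3) show ?thesis
    by (rule has_integral_le)
qed

lemma inner_matrix_vector_le:
  fixes P :: "real^'n^'n"
  assumes "\<And>v. norm (P *v v) \<le> k * norm v"
  shows "\<bar>a \<bullet> (P *v b)\<bar> \<le> k * norm a * norm b"
  using Cauchy_Schwarz_ineq2[of a "P *v b"] mult_left_mono[OF assms[of b] norm_ge_zero[of a]]
  by (simp add: algebra_simps)

lemma lyapunov_derivative_shift:
  fixes P :: "real^'n^'n"
  assumes P_bound: "\<And>v. norm (P *v v) \<le> k * norm v" and "0 \<le> k" and "0 \<le> \<alpha>"
    and "norm f \<le> M" and "norm (z0 - z1) \<le> \<delta>" and "norm z0 \<le> R" and "norm z1 \<le> R"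
    and decrease: "f \<bullet> (P *v z1) + z1 \<bullet> (P *v f) \<le> - \<alpha> * (z1 \<bullet> (P *v z1)) + \<beta>"
  shows "f \<bullet> (P *v z0) + z0 \<bullet> (P *v f) \<le> - \<alpha> * (z0 \<bullet> (P *v z0)) + \<beta> + \<delta> * (2 * k * M + 2 * \<alpha> * k * R)"
proof -
  note bound = inner_matrix_vector_le[OF P_bound]
  have "0 \<le> M" "0 \<le> \<delta>" "0 \<le> R"
    using assms(4-6) by (auto intro: order_trans[OF norm_ge_zero])
  have "k * norm f * norm (z0 - z1) \<le> k * M * \<delta>"
    using assms(4,5) \<open>0 \<le> k\<close> \<open>0 \<le> M\<close> by (intro mult_mono mult_left_mono) auto
  then have pert: "f \<bullet> (P *v (z0 - z1)) + (z0 - z1) \<bullet> (P *v f) \<le> 2 * (k * M * \<delta>)"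
    using bound[of f "z0 - z1"] bound[of "z0 - z1" f] by (simp add: mult_ac)
  have "k * norm (z0 - z1) * norm z0 \<le> k * \<delta> * R" "k * norm z1 * norm (z0 - z1) \<le> k * R * \<delta>"
    using assms(5-7) \<open>0 \<le> k\<close> \<open>0 \<le> R\<close> \<open>0 \<le> \<delta>\<close> by (intro mult_mono mult_left_mono; simp)+
  moreover have "z0 \<bullet> (P *v z0) - z1 \<bullet> (P *v z1) = (z0 - z1) \<bullet> (P *v z0) + z1 \<bullet> (P *v (z0 - z1))"
    by (simp add: inner_diff_left inner_diff_right matrix_vector_mult_diff_distrib)
  ultimately have "z0 \<bullet> (P *v z0) - z1 \<bullet> (P *v z1) \<le> 2 * k * R * \<delta>"
    using bound[of "z0 - z1" z0] bound[of z1 "z0 - z1"] by (simp add: mult_ac)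
  then have "\<alpha> * (z0 \<bullet> (P *v z0)) - \<alpha> * (z1 \<bullet> (P *v z1)) \<le> \<alpha> * (2 * k * R * \<delta>)"
    using \<open>0 \<le> \<alpha>\<close> by (simp flip: right_diff_distrib add: mult_left_mono)
  moreover have "f \<bullet> (P *v z0) + z0 \<bullet> (P *v f)
      = (f \<bullet> (P *v z1) + z1 \<bullet> (P *v f)) + (f \<bullet> (P *v (z0 - z1)) + (z0 - z1) \<bullet> (P *v f))"
    by (simp add: inner_diff_left inner_diff_right matrix_vector_mult_diff_distrib)
  moreover have "\<delta> * (2 * k * M + 2 * \<alpha> * k * R) = 2 * (k * M * \<delta>) + \<alpha> * (2 * k * R * \<delta>)"
    by (simp add: algebra_simps)
  ultimately show ?thesis
    using decrease pert by linarith
qed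

lemma quadratic_form_increment:
  fixes P :: "real^'n^'n" and z F :: "real \<Rightarrow> real^'n"
  assumes P_bound: "\<And>v. norm (P *v v) \<le> k * norm v" and "0 \<le> k" and "0 \<le> \<alpha>"
    and integral: "(F has_integral (z t - z t0)) {t0..t}" and "t0 \<le> t"
    and bounds: "\<And>r. t0 \<le> r \<Longrightarrow> r \<le> t \<Longrightarrow>
        norm (F r) \<le> M \<and> norm (z r - z t0) \<le> (r - t0) * M \<and> norm (z r) \<le> R"
    and decrease: "\<And>r. t0 \<le> r \<Longrightarrow> r \<le> t \<Longrightarrow>
        F r \<bullet> (P *v z r) + z r \<bullet> (P *v F r) \<le> - \<alpha> * (z r \<bullet> (P *v z r)) + \<beta>"
  shows "z t \<bullet> (P *v z t) - z t0 \<bullet> (P *v z t0)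
    \<le> (t - t0) * (- \<alpha> * (z t0 \<bullet> (P *v z t0)) + \<beta>) + (t - t0)\<^sup>2 * (3 * k * M\<^sup>2 + 2 * \<alpha> * k * M * R)"
proof -
  define s where "s = t - t0"
  define z0 where "z0 = z t0"
  have "0 \<le> M"
    using bounds[of t0] \<open>t0 \<le> t\<close> by (auto intro: order_trans[OF norm_ge_zero])
  have near: "norm (z0 - z r) \<le> s * M" if "r \<in> {t0..t}" for r
  proof -
    have "(r - t0) * M \<le> s * M"
      using that \<open>0 \<le> M\<close> by (auto simp: s_def intro: mult_right_mono)
    then show ?thesis
      using bounds[of r] that by (auto simp: z0_def norm_minus_commute)
  qed
  define bound where "bound = - \<alpha> * (z0 \<bullet> (P *v z0)) + \<beta> + s * M * (2 * k * M + 2 * \<alpha> * k * R)"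
  have pointwise: "F r \<bullet> (P *v z0) + z0 \<bullet> (P *v F r) \<le> bound" if "r \<in> {t0..t}" for r
    unfolding bound_def
  proof (rule lyapunov_derivative_shift[OF P_bound \<open>0 \<le> k\<close> \<open>0 \<le> \<alpha>\<close> _ near[OF that]])
    show "norm (F r) \<le> M" "norm z0 \<le> R" "norm (z r) \<le> R"
      using bounds[of r] bounds[of t0] that \<open>t0 \<le> t\<close> by (auto simp: z0_def)
  qed (use decrease that in auto)
  have "bounded_linear (\<lambda>v. v \<bullet> (P *v z0) + z0 \<bullet> (P *v v))"
    by (auto intro!: linear_conv_bounded_linear[THEN iffD1] linearI
        simp: inner_add_left inner_add_right matrix_vector_right_distrib matrix_vector_mult_scaleR
          algebra_simps)
  then have "((\<lambda>r. F r \<bullet> (P *v z0) + z0 \<bullet> (P *v F r))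
      has_integral (z t - z0) \<bullet> (P *v z0) + z0 \<bullet> (P *v (z t - z0))) {t0..t}"
    using has_integral_linear[OF integral] by (simp add: o_def z0_def)
  then have linear_part: "(z t - z0) \<bullet> (P *v z0) + z0 \<bullet> (P *v (z t - z0)) \<le> s * bound"
    unfolding s_def using \<open>t0 \<le> t\<close> pointwise by (rule has_integral_le_const_real)
  have "k * norm (z t - z0) * norm (z t - z0) \<le> k * (s * M) * (s * M)"
    using near[of t] \<open>t0 \<le> t\<close> \<open>0 \<le> k\<close> order_trans[OF norm_ge_zero near[of t]]
    by (intro mult_mono mult_left_mono) (auto simp: norm_minus_commute)
  then have remainder: "(z t - z0) \<bullet> (P *v (z t - z0)) \<le> k * (s * M)\<^sup>2"
    using inner_matrix_vector_le[OF P_bound, of "z t - z0" "z t - z0"] by (simp add: power2_eq_square)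
  have "z t \<bullet> (P *v z t) = z0 \<bullet> (P *v z0) + ((z t - z0) \<bullet> (P *v z0) + z0 \<bullet> (P *v (z t - z0)))
      + (z t - z0) \<bullet> (P *v (z t - z0))"
    by (simp add: inner_diff_left inner_diff_right matrix_vector_mult_diff_distrib)
  moreover have "s * bound + k * (s * M)\<^sup>2
      = s * (- \<alpha> * (z0 \<bullet> (P *v z0)) + \<beta>) + s\<^sup>2 * (3 * k * M\<^sup>2 + 2 * \<alpha> * k * M * R)"
    by (simp add: bound_def power2_eq_square algebra_simps)
  ultimately show ?thesis
    using linear_part remainder by (simp add: s_def z0_def)
qed

lemma quadratic_form_coercive:
  fixes P :: "real^'n^'n"
  assumes pos: "\<forall>z. z \<noteq> 0 \<longrightarrow> z \<bullet> (P *v z) > 0"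
  obtains l where "0 < l" and "\<And>z. l * norm z ^ 2 \<le> z \<bullet> (P *v z)"
proof -
  have cont: "continuous_on (sphere 0 1) (\<lambda>z::real^'n. z \<bullet> (P *v z))"
    by (intro continuous_intros linear_continuous_on) simp
  obtain z0 where z0: "z0 \<in> sphere 0 1" and min: "\<And>z. z \<in> sphere 0 1 \<Longrightarrow> z0 \<bullet> (P *v z0) \<le> z \<bullet> (P *v z)"
    using continuous_attains_inf[OF compact_sphere _ cont] by auto
  show ?thesis
  proof (rule that)
    have "z0 \<noteq> 0"
      using z0 by auto
    then show "0 < z0 \<bullet> (P *v z0)"
      using pos by blast
    show "z0 \<bullet> (P *v z0) * norm z ^ 2 \<le> z \<bullet> (P *v z)" for z
    proof (cases "z = 0")
      case False
      define v where "v = (1 / norm z) *\<^sub>R z"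
      have "v \<in> sphere 0 1" and z_eq: "z = norm z *\<^sub>R v"
        using False by (simp_all add: v_def)
      have "z \<bullet> (P *v z) = norm z ^ 2 * (v \<bullet> (P *v v))"
        by (subst (1 2) z_eq) (simp add: matrix_vector_mult_scaleR power2_eq_square)
      then show ?thesis
        using min[OF \<open>v \<in> sphere 0 1\<close>] by (metis mult.commute mult_right_mono zero_le_power2)
    qed simp
  qed
qed

lemma drift_term_bound:
  fixes k l \<alpha> \<kappa> c R :: real
  assumes "0 < l" and "0 < \<alpha>" and "0 \<le> R" and small: "8 * k * \<kappa> \<le> l * \<alpha> * exp (- \<alpha>)"
  shows "2 * k * R * (\<kappa> * R + c) \<le> \<alpha> * exp (- \<alpha>) / 2 * (l * R\<^sup>2) + 4 * (k * c)\<^sup>2 / (l * \<alpha> * exp (- \<alpha>))"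
proof -
  define \<delta> where "\<delta> = l * \<alpha> * exp (- \<alpha>) / 4"
  have "0 < \<delta>"
    using assms(1,2) by (simp add: \<delta>_def)
  have "0 \<le> (\<delta> * R - k * c)\<^sup>2 / \<delta>"
    using \<open>0 < \<delta>\<close> by simp
  then have young: "2 * R * (k * c) \<le> \<delta> * R\<^sup>2 + (k * c)\<^sup>2 / \<delta>"
    using \<open>0 < \<delta>\<close> by (simp add: power2_eq_square field_simps)
  moreover have "2 * k * \<kappa> * R\<^sup>2 \<le> \<delta> * R\<^sup>2"
    using small by (intro mult_right_mono) (simp_all add: \<delta>_def)
  moreover have "\<alpha> * exp (- \<alpha>) / 2 * (l * R\<^sup>2) = 2 * (\<delta> * R\<^sup>2)"
    and "4 * (k * c)\<^sup>2 / (l * \<alpha> * exp (- \<alpha>)) = (k * c)\<^sup>2 / \<delta>"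
    by (simp_all add: \<delta>_def)
  moreover have "2 * k * R * (\<kappa> * R + c) = 2 * k * \<kappa> * R\<^sup>2 + 2 * R * (k * c)"
    by (simp add: power2_eq_square algebra_simps)
  ultimately show ?thesis
    by linarith
qed

lemma second_order_term_bound:
  fixes a b c R \<alpha> :: real
  assumes "0 \<le> c" and "0 \<le> \<alpha>"
  shows "3 * c * (a * R + b)\<^sup>2 + 2 * \<alpha> * c * (a * R + b) * R
    \<le> (2 * (3 + \<alpha>) * c * a\<^sup>2 + \<alpha> * c) * R\<^sup>2 + 2 * (3 + \<alpha>) * c * b\<^sup>2"
proof -
  have square: "(a * R + b)\<^sup>2 \<le> 2 * a\<^sup>2 * R\<^sup>2 + 2 * b\<^sup>2"
    using zero_le_power2[of "a * R - b"] by (simp add: power2_eq_square algebra_simps)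
  have "2 * (a * R + b) * R \<le> (a * R + b)\<^sup>2 + R\<^sup>2"
    using zero_le_power2[of "a * R + b - R"] by (simp add: power2_eq_square algebra_simps)
  then have "3 * c * (a * R + b)\<^sup>2 + \<alpha> * c * (2 * (a * R + b) * R)
      \<le> 3 * c * (a * R + b)\<^sup>2 + \<alpha> * c * ((a * R + b)\<^sup>2 + R\<^sup>2)"
    using assms by (intro add_left_mono mult_left_mono) auto
  also have "\<dots> = (3 + \<alpha>) * c * (a * R + b)\<^sup>2 + \<alpha> * c * R\<^sup>2"
    by (simp add: algebra_simps)
  also have "\<dots> \<le> (3 + \<alpha>) * c * (2 * a\<^sup>2 * R\<^sup>2 + 2 * b\<^sup>2) + \<alpha> * c * R\<^sup>2"
    using square assms by (intro add_right_mono mult_left_mono) auto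
  finally show ?thesis
    by (simp add: algebra_simps)
qed

section \<open>Comparison functions\<close>

lemma class_KL_exponential:
  assumes "0 < c" and "0 < m"
  shows "class_KL (\<lambda>r t. c * r * exp (- m * t))"
  unfolding class_KL_def class_K_def
proof (intro conjI allI impI)
  show "continuous_on ({0..} \<times> {0..}) (\<lambda>(r, t). c * r * exp (- m * t))"
    by (simp add: case_prod_beta') (intro continuous_intros)
  fix t :: real
  show "continuous_on {0..} (\<lambda>r. c * r * exp (- m * t))"
    by (intro continuous_intros)
  show "strict_mono_on {0..} (\<lambda>r. c * r * exp (- m * t))"
    by (rule monotone_onI) (use assms in simp)
  show "c * 0 * exp (- m * t) = 0"
    by simp
next
  fix r :: real
  assume "0 \<le> r"
  show "antimono_on {0..} (\<lambda>t. c * r * exp (- m * t))"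
    by (rule monotone_onI) (use assms \<open>0 \<le> r\<close> in \<open>auto intro!: mult_left_mono\<close>)
  have "((\<lambda>t. exp (- m * t)) \<longlongrightarrow> 0) at_top"
    using \<open>0 < m\<close> by real_asymp
  then show "((\<lambda>t. c * r * exp (- m * t)) \<longlongrightarrow> 0) at_top"
    by (rule tendsto_mult_right_zero)
qed

lemma class_K_id: "class_K (\<lambda>r. r)"
  unfolding class_K_def by (auto intro: monotone_onI)

section \<open>The closed loop\<close>

lemma onorm_matrix_vector_nonneg [simp]: "0 \<le> onorm ((*v) (M :: real^'n^'m))"
  by (simp add: onorm_pos_le)

lemma norm_matrix_vector_le:
  fixes M :: "real^'n^'m"
  shows "onorm ((*v) M) \<le> c \<Longrightarrow> norm (M *v v) \<le> c * norm v"
  using onorm[OF matrix_vector_mul_bounded_linear, of M v] mult_right_mono[of _ c "norm v"] by force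

locale etm_plant =
  fixes A :: "real^'x^'x" and B :: "real^'u^'x" and C :: "real^'x^'y" and Cq :: "real^'x^'q"
    and E :: "real^'p^'x" and Ew :: "real^'w^'x" and p :: "real^'q \<Rightarrow> real^'p"
    and K1 :: "real^'x^'u" and K2 :: "real^'p^'u" and L1 :: "real^'y^'q" and L2 :: "real^'y^'x"
    and P :: "real^('x + 'x)^('x + 'x)" and \<alpha> Lp l :: real
  assumes p_zero: "p 0 = 0" and p_lipschitz: "Lp-lipschitz_on UNIV p"
    and P_coercive: "\<And>z. l * norm z ^ 2 \<le> z \<bullet> (P *v z)" and l_pos: "0 < l" and \<alpha>_pos: "0 < \<alpha>"
    and nominal: "\<forall>x xh.
      let u = K1 *v xh + K2 *v p (Cq *v xh);
          dx = A *v x + B *v u + E *v p (Cq *v x);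
          dxh = A *v xh + B *v u + E *v p (Cq *v xh + L1 *v (C *v xh - C *v x))
                + L2 *v (C *v xh - C *v x);
          z = stack x (x - xh);
          dz = stack dx (dx - dxh)
      in dz \<bullet> (P *v z) + z \<bullet> (P *v dz) \<le> - \<alpha> * (z \<bullet> (P *v z))"
begin

definition matrix_gains :: "real set"
  where "matrix_gains = {onorm ((*v) A), onorm ((*v) B), onorm ((*v) C), onorm ((*v) Cq),
    onorm ((*v) E), onorm ((*v) Ew), onorm ((*v) K1), onorm ((*v) K2), onorm ((*v) L1),
    onorm ((*v) L2), onorm ((*v) P)}"

text \<open>One constant bounds all gains, so that every Lipschitz constant below is a power of \<open>k\<close>.\<close>

definition k :: real
  where "k = 1 + Lp + Max matrix_gains"

lemma k_ge_1: "1 \<le> k"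
  and gains: "norm (A *v xa) \<le> k * norm xa" "norm (B *v ua) \<le> k * norm ua" "norm (C *v xa) \<le> k * norm xa"
    "norm (Cq *v xa) \<le> k * norm xa" "norm (E *v pa) \<le> k * norm pa" "norm (Ew *v wa) \<le> k * norm wa"
    "norm (K1 *v xa) \<le> k * norm xa" "norm (K2 *v pa) \<le> k * norm pa" "norm (L1 *v ya) \<le> k * norm ya"
    "norm (L2 *v ya) \<le> k * norm ya" "norm (P *v za) \<le> k * norm za"
  and p_lipschitz_k: "norm (p qa - p qb) \<le> k * norm (qa - qb)"
proof -
  have "0 \<le> Lp"
    using p_lipschitz by (rule lipschitz_on_nonneg)
  have "finite matrix_gains"
    by (simp add: matrix_gains_def)
  then have le_k: "s \<le> k - 1 - Lp" if "s \<in> matrix_gains" for s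
    using Max_ge[OF _ that] by (simp add: k_def)
  show "norm (A *v xa) \<le> k * norm xa" "norm (B *v ua) \<le> k * norm ua" "norm (C *v xa) \<le> k * norm xa"
    "norm (Cq *v xa) \<le> k * norm xa" "norm (E *v pa) \<le> k * norm pa" "norm (Ew *v wa) \<le> k * norm wa"
    "norm (K1 *v xa) \<le> k * norm xa" "norm (K2 *v pa) \<le> k * norm pa" "norm (L1 *v ya) \<le> k * norm ya"
    "norm (L2 *v ya) \<le> k * norm ya" "norm (P *v za) \<le> k * norm za"
    by (rule norm_matrix_vector_le, rule order_trans[OF le_k], simp add: matrix_gains_def,
        insert \<open>0 \<le> Lp\<close>, linarith)+
  have P_gain: "onorm ((*v) P) \<le> k - 1 - Lp"
    by (rule le_k) (simp add: matrix_gains_def)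
  show "1 \<le> k"
    using P_gain onorm_matrix_vector_nonneg[of P] \<open>0 \<le> Lp\<close> by linarith
  have "norm (p qa - p qb) \<le> Lp * norm (qa - qb)"
    using lipschitz_onD[OF p_lipschitz] by (simp add: dist_norm)
  also have "\<dots> \<le> k * norm (qa - qb)"
    using P_gain onorm_matrix_vector_nonneg[of P] by (intro mult_right_mono) (linarith, simp)
  finally show "norm (p qa - p qb) \<le> k * norm (qa - qb)" .
qed

lemma k_nonneg: "0 \<le> k"
  using k_ge_1 by simp

definition control :: "real^'x \<Rightarrow> real^'u"
  where "control xs = K1 *v xs + K2 *v p (Cq *v xs)"

definition plant_field :: "real^'x \<Rightarrow> real^'x \<Rightarrow> real^'w \<Rightarrow> real^'x"
  where "plant_field x xs wv = A *v x + B *v control xs + E *v p (Cq *v x) + Ew *v wv"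

definition observer_field :: "real^'x \<Rightarrow> real^'x \<Rightarrow> real^'y \<Rightarrow> real^'x"
  where "observer_field xh xs yv = A *v xh + B *v control xs + E *v p (Cq *v xh + L1 *v (C *v xh - yv))
    + L2 *v (C *v xh - yv)"

definition closed_loop_field :: "real^'x \<Rightarrow> real^'x \<Rightarrow> real^'x \<Rightarrow> real^'y \<Rightarrow> real^'w \<Rightarrow> real^('x + 'x)"
  where "closed_loop_field x xh xs yv wv =
    stack (plant_field x xs wv) (plant_field x xs wv - observer_field xh xs yv)"

definition field_lipschitz :: real
  where "field_lipschitz = 8 * k ^ 4"

lemma k_power_mono: "i \<le> j \<Longrightarrow> 0 \<le> r \<Longrightarrow> k ^ i * r \<le> k ^ j * r"
  using power_increasing[OF _ k_ge_1] by (simp add: mult_right_mono)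

lemma k_le_power: "1 \<le> j \<Longrightarrow> 0 \<le> r \<Longrightarrow> k * r \<le> k ^ j * r"
  using k_power_mono[of 1 j r] by simp

lemma k_mult_le_trans: "a \<le> k * b \<Longrightarrow> b \<le> c \<Longrightarrow> a \<le> k * c"
  by (erule order_trans) (rule mult_left_mono[OF _ k_nonneg])

lemma control_lipschitz: "norm (control a - control b) \<le> 2 * k ^ 3 * norm (a - b)"
proof -
  have "control a - control b = K1 *v (a - b) + K2 *v (p (Cq *v a) - p (Cq *v b))"
    by (simp add: control_def matrix_vector_mult_diff_distrib)
  then have "norm (control a - control b) \<le> norm (K1 *v (a - b)) + norm (K2 *v (p (Cq *v a) - p (Cq *v b)))"
    by (metis norm_triangle_ineq)
  also have "norm (K1 *v (a - b)) \<le> k ^ 3 * norm (a - b)"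
    by (rule order_trans[OF gains(7) k_le_power]) simp_all
  also have "norm (K2 *v (p (Cq *v a) - p (Cq *v b))) \<le> k * (k * (k * norm (a - b)))"
    using gains(4)[of "a - b"]
    by (intro k_mult_le_trans[OF gains(8)] k_mult_le_trans[OF p_lipschitz_k])
      (simp add: matrix_vector_mult_diff_distrib)
  finally show ?thesis
    by (simp add: power3_eq_cube mult_ac)
qed

lemma plant_field_lipschitz:
  "norm (plant_field x xs wv - plant_field x' xs' wv')
    \<le> 2 * k ^ 4 * (norm (x - x') + norm (xs - xs') + norm (wv - wv'))"
proof -
  have "plant_field x xs wv - plant_field x' xs' wv'
      = A *v (x - x') + B *v (control xs - control xs') + E *v (p (Cq *v x) - p (Cq *v x'))
        + Ew *v (wv - wv')"
    by (simp add: plant_field_def matrix_vector_mult_diff_distrib algebra_simps)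
  then have "norm (plant_field x xs wv - plant_field x' xs' wv')
      \<le> norm (A *v (x - x')) + norm (B *v (control xs - control xs'))
        + norm (E *v (p (Cq *v x) - p (Cq *v x'))) + norm (Ew *v (wv - wv'))"
    by (simp only: norm_triangle_le norm_triangle_ineq add_right_mono)
  also have "norm (A *v (x - x')) \<le> k ^ 4 * norm (x - x')"
    by (rule order_trans[OF gains(1) k_le_power]) simp_all
  also have "norm (B *v (control xs - control xs')) \<le> k * (2 * k ^ 3 * norm (xs - xs'))"
    by (rule k_mult_le_trans[OF gains(2) control_lipschitz])
  also have "norm (E *v (p (Cq *v x) - p (Cq *v x'))) \<le> k * (k * (k * norm (x - x')))"
    using gains(4)[of "x - x'"]
    by (intro k_mult_le_trans[OF gains(5)] k_mult_le_trans[OF p_lipschitz_k])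
      (simp add: matrix_vector_mult_diff_distrib)
  also have "\<dots> \<le> k ^ 4 * norm (x - x')"
    using k_power_mono[of 3 4 "norm (x - x')"] by (simp add: power3_eq_cube)
  also have "norm (Ew *v (wv - wv')) \<le> k ^ 4 * norm (wv - wv')"
    by (rule order_trans[OF gains(6) k_le_power]) simp_all
  finally have "norm (plant_field x xs wv - plant_field x' xs' wv')
      \<le> k ^ 4 * norm (x - x') + k * (2 * k ^ 3 * norm (xs - xs')) + k ^ 4 * norm (x - x')
        + k ^ 4 * norm (wv - wv')"
    by simp
  moreover have "k ^ 4 * norm (wv - wv') \<le> 2 * k ^ 4 * norm (wv - wv')"
    using k_nonneg by simp
  ultimately show ?thesis
    by (simp add: power_numeral_reduce algebra_simps)
qed

lemma injection_lipschitz: "norm ((C *v xh - yv) - (C *v xh' - yv')) \<le> k * norm (xh - xh') + norm (yv - yv')"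
proof -
  have "norm ((C *v xh - yv) - (C *v xh' - yv')) = norm (C *v (xh - xh') - (yv - yv'))"
    by (simp add: matrix_vector_mult_diff_distrib algebra_simps)
  also have "\<dots> \<le> norm (C *v (xh - xh')) + norm (yv - yv')"
    by (rule norm_triangle_ineq4)
  also have "\<dots> \<le> k * norm (xh - xh') + norm (yv - yv')"
    using gains(3) by simp
  finally show ?thesis .
qed

lemma observer_field_lipschitz:
  "norm (observer_field xh xs yv - observer_field xh' xs' yv')
    \<le> 4 * k ^ 4 * (norm (xh - xh') + norm (xs - xs') + norm (yv - yv'))"
proof -
  define e e' where "e = C *v xh - yv" and "e' = C *v xh' - yv'"
  have e_diff: "norm (e - e') \<le> k * norm (xh - xh') + norm (yv - yv')"
    unfolding e_def e'_def by (rule injection_lipschitz)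
  have "(Cq *v xh + L1 *v e) - (Cq *v xh' + L1 *v e') = Cq *v (xh - xh') + L1 *v (e - e')"
    by (simp add: matrix_vector_mult_diff_distrib)
  then have arg_diff: "norm ((Cq *v xh + L1 *v e) - (Cq *v xh' + L1 *v e'))
      \<le> k * norm (xh - xh') + k * (k * norm (xh - xh') + norm (yv - yv'))"
    using norm_triangle_ineq[of "Cq *v (xh - xh')" "L1 *v (e - e')"] gains(4)[of "xh - xh'"]
      k_mult_le_trans[OF gains(9) e_diff] by simp
  have "observer_field xh xs yv - observer_field xh' xs' yv'
      = A *v (xh - xh') + B *v (control xs - control xs')
        + E *v (p (Cq *v xh + L1 *v e) - p (Cq *v xh' + L1 *v e')) + L2 *v (e - e')"
    by (simp add: observer_field_def e_def e'_def matrix_vector_mult_diff_distrib algebra_simps)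
  then have "norm (observer_field xh xs yv - observer_field xh' xs' yv')
      \<le> norm (A *v (xh - xh')) + norm (B *v (control xs - control xs'))
        + norm (E *v (p (Cq *v xh + L1 *v e) - p (Cq *v xh' + L1 *v e'))) + norm (L2 *v (e - e'))"
    by (simp only: norm_triangle_le norm_triangle_ineq add_right_mono)
  also have "norm (A *v (xh - xh')) \<le> k ^ 4 * norm (xh - xh')"
    by (rule order_trans[OF gains(1) k_le_power]) simp_all
  also have "norm (B *v (control xs - control xs')) \<le> k * (2 * k ^ 3 * norm (xs - xs'))"
    by (rule k_mult_le_trans[OF gains(2) control_lipschitz])
  also have "norm (E *v (p (Cq *v xh + L1 *v e) - p (Cq *v xh' + L1 *v e')))
      \<le> k * (k * (k * norm (xh - xh') + k * (k * norm (xh - xh') + norm (yv - yv'))))"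
    by (intro k_mult_le_trans[OF gains(5)] k_mult_le_trans[OF p_lipschitz_k] arg_diff)
  also have "norm (L2 *v (e - e')) \<le> k * (k * norm (xh - xh') + norm (yv - yv'))"
    by (rule k_mult_le_trans[OF gains(10) e_diff])
  finally have "norm (observer_field xh xs yv - observer_field xh' xs' yv')
      \<le> k ^ 4 * norm (xh - xh') + k * (2 * k ^ 3 * norm (xs - xs'))
        + k * (k * (k * norm (xh - xh') + k * (k * norm (xh - xh') + norm (yv - yv'))))
        + k * (k * norm (xh - xh') + norm (yv - yv'))"
    by simp
  moreover have "k ^ 3 * norm (xh - xh') \<le> k ^ 4 * norm (xh - xh')"
    "k ^ 2 * norm (xh - xh') \<le> k ^ 4 * norm (xh - xh')"
    "k ^ 3 * norm (yv - yv') \<le> k ^ 4 * norm (yv - yv')"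
    "k * norm (yv - yv') \<le> k ^ 4 * norm (yv - yv')"
    "0 \<le> k ^ 4 * norm (xs - xs')" "0 \<le> k ^ 4 * norm (yv - yv')"
    by (simp_all add: k_power_mono k_le_power k_nonneg)
  ultimately show ?thesis
    by (simp add: power_numeral_reduce algebra_simps)
qed

lemma closed_loop_field_lipschitz:
  "norm (closed_loop_field x xh xs yv wv - closed_loop_field x' xh' xs' yv' wv')
    \<le> field_lipschitz
      * (norm (x - x') + norm (xh - xh') + norm (xs - xs') + norm (yv - yv') + norm (wv - wv'))"
proof -
  define dX dH where "dX = plant_field x xs wv - plant_field x' xs' wv'"
    and "dH = observer_field xh xs yv - observer_field xh' xs' yv'"
  have "closed_loop_field x xh xs yv wv - closed_loop_field x' xh' xs' yv' wv' = stack dX (dX - dH)"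
    by (simp add: closed_loop_field_def dX_def dH_def algebra_simps flip: stack_diff)
  then have "norm (closed_loop_field x xh xs yv wv - closed_loop_field x' xh' xs' yv' wv')
      \<le> 2 * norm dX + norm dH"
    using norm_stack_le[of dX "dX - dH"] norm_triangle_ineq4[of dX dH] by simp
  also have "\<dots> \<le> 2 * (2 * k ^ 4 * (norm (x - x') + norm (xs - xs') + norm (wv - wv')))
      + 4 * k ^ 4 * (norm (xh - xh') + norm (xs - xs') + norm (yv - yv'))"
    unfolding dX_def dH_def
    by (intro add_mono mult_left_mono plant_field_lipschitz observer_field_lipschitz) simp
  also have "\<dots> = field_lipschitz
      * (norm (x - x') + norm (xh - xh') + norm (xs - xs') + norm (yv - yv') + norm (wv - wv'))
      - 4 * k ^ 4 * (norm (x - x') + norm (xh - xh') + norm (yv - yv') + norm (wv - wv'))"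
    by (simp add: field_lipschitz_def algebra_simps)
  also have "\<dots> \<le> field_lipschitz
      * (norm (x - x') + norm (xh - xh') + norm (xs - xs') + norm (yv - yv') + norm (wv - wv'))"
    using k_nonneg by simp
  finally show ?thesis .
qed

lemma lyapunov_derivative_le:
  fixes x xh xs :: "real^'x" and yv :: "real^'y" and wv :: "real^'w"
  defines "z \<equiv> stack x (x - xh)" and "f \<equiv> closed_loop_field x xh xs yv wv"
    and "f0 \<equiv> closed_loop_field x xh xh (C *v x) 0"
  shows "f \<bullet> (P *v z) + z \<bullet> (P *v f) \<le> - \<alpha> * (z \<bullet> (P *v z)) + 2 * k * norm z * norm (f - f0)"
proof -
  have "f0 \<bullet> (P *v z) + z \<bullet> (P *v f0) \<le> - \<alpha> * (z \<bullet> (P *v z))"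
    using spec[OF spec[OF nominal, of x], of xh]
    by (simp add: Let_def z_def f0_def closed_loop_field_def plant_field_def observer_field_def control_def)
  moreover have "(f - f0) \<bullet> (P *v z) \<le> k * norm z * norm (f - f0)"
    "z \<bullet> (P *v (f - f0)) \<le> k * norm z * norm (f - f0)"
    using Cauchy_Schwarz_ineq2[of "f - f0" "P *v z"] Cauchy_Schwarz_ineq2[of z "P *v (f - f0)"]
      mult_left_mono[OF gains(11)[of z] norm_ge_zero[of "f - f0"]]
      mult_left_mono[OF gains(11)[of "f - f0"] norm_ge_zero[of z]]
    by (simp_all add: algebra_simps)
  moreover have "f \<bullet> (P *v z) + z \<bullet> (P *v f)
      = (f0 \<bullet> (P *v z) + z \<bullet> (P *v f0)) + ((f - f0) \<bullet> (P *v z) + z \<bullet> (P *v (f - f0)))"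
    by (simp add: inner_diff_left inner_diff_right matrix_vector_mult_diff_distrib)
  ultimately show ?thesis
    by linarith
qed

abbreviation V :: "real^('x + 'x) \<Rightarrow> real"
  where "V z \<equiv> z \<bullet> (P *v z)"

definition window_growth :: "real \<Rightarrow> real"
  where "window_growth \<sigma> = field_lipschitz * (3 + (1 + \<sigma>) * (2 + k))"

definition window_offset :: "real \<Rightarrow> real \<Rightarrow> real"
  where "window_offset \<epsilon> \<omega> = field_lipschitz * (2 * \<epsilon> + \<omega>)"

definition sampling_gain :: "real \<Rightarrow> real \<Rightarrow> real"
  where "sampling_gain \<tau> \<sigma> = field_lipschitz * (2 + k) * (\<tau> * window_growth \<sigma> + \<sigma>)"

definition sampling_offset :: "real \<Rightarrow> real \<Rightarrow> real \<Rightarrow> real"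
  where "sampling_offset \<tau> \<epsilon> \<omega> = field_lipschitz * ((2 + k) * \<tau> * window_offset \<epsilon> \<omega> + 2 * \<epsilon> + \<omega>)"

definition lyapunov_offset :: "real \<Rightarrow> real \<Rightarrow> real \<Rightarrow> real"
  where "lyapunov_offset \<tau> \<epsilon> \<omega> = 4 * (k * sampling_offset \<tau> \<epsilon> \<omega>)\<^sup>2 / (l * \<alpha> * exp (- \<alpha>))"

definition ultimate_bound :: "real \<Rightarrow> real \<Rightarrow> real \<Rightarrow> real"
  where "ultimate_bound \<tau> \<epsilon> \<omega> = 2 * lyapunov_offset \<tau> \<epsilon> \<omega> / \<alpha> + 1"

lemma ultimate_bound_nonneg: "0 \<le> ultimate_bound \<tau> \<epsilon> \<omega>"
  using l_pos \<alpha>_pos by (simp add: ultimate_bound_def lyapunov_offset_def)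

lemma field_lipschitz_nonneg: "0 \<le> field_lipschitz"
  by (simp add: field_lipschitz_def k_nonneg)

lemma closed_loop_field_zero: "closed_loop_field 0 0 0 0 0 = 0"
  by (simp add: closed_loop_field_def plant_field_def observer_field_def control_def p_zero
      vec_eq_iff stack_def split: sum.split)

lemma small_sampling_parameter:
  obtains \<theta> where "0 < \<theta>" and "\<theta> \<le> 1" and "8 * k * sampling_gain \<theta> \<theta> \<le> l * \<alpha> * exp (- \<alpha>)"
proof -
  have "((\<lambda>\<theta>. 8 * k * sampling_gain \<theta> \<theta>) \<longlongrightarrow> 8 * k * sampling_gain 0 0) (at_right 0)"
    unfolding sampling_gain_def window_growth_def by (intro tendsto_intros)
  moreover have "8 * k * sampling_gain 0 0 < l * \<alpha> * exp (- \<alpha>)"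
    using l_pos \<alpha>_pos by (simp add: sampling_gain_def)
  ultimately have "\<forall>\<^sub>F \<theta> in at_right 0. 8 * k * sampling_gain \<theta> \<theta> < l * \<alpha> * exp (- \<alpha>)"
    by (rule order_tendstoD(2))
  moreover have "\<forall>\<^sub>F \<theta> in at_right (0::real). \<theta> < 1"
    by (rule order_tendstoD(2)[OF tendsto_ident_at zero_less_one])
  ultimately have "\<forall>\<^sub>F \<theta> in at_right 0. 0 < \<theta> \<and> \<theta> \<le> 1 \<and> 8 * k * sampling_gain \<theta> \<theta> \<le> l * \<alpha> * exp (- \<alpha>)"
    using eventually_at_right_less[of 0] by eventually_elim auto
  then show ?thesis
    using that eventually_happens'[OF trivial_limit_at_right_real] by blast
qed

end

section \<open>Trajectories of the event-triggered loop\<close>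

locale etm_trajectory = etm_plant +
  fixes \<tau> \<sigma> \<epsilon> \<omega> :: real and x xh xhs ys w
  assumes \<tau>_pos: "0 < \<tau>" and \<sigma>_nonneg: "0 \<le> \<sigma>" and \<epsilon>_nonneg: "0 \<le> \<epsilon>"
    and w_bound: "\<And>t. 0 \<le> t \<Longrightarrow> norm (w t) \<le> \<omega>"
    and estimate_held: "etm_held xh xhs \<tau> \<sigma> \<epsilon>"
    and output_held: "etm_held (\<lambda>t. C *v x t) ys \<tau> \<sigma> \<epsilon>"
    and plant_solution: "\<And>t. 0 \<le> t \<Longrightarrow> ((\<lambda>s. plant_field (x s) (xhs s) (w s)) has_integral (x t - x 0)) {0..t}"
    and observer_solution: "\<And>t. 0 \<le> t \<Longrightarrow>
      ((\<lambda>s. observer_field (xh s) (xhs s) (ys s)) has_integral (xh t - xh 0)) {0..t}"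
begin

definition z
  where "z t = stack (x t) (x t - xh t)"

definition zdot
  where "zdot t = closed_loop_field (x t) (xh t) (xhs t) (ys t) (w t)"

lemma z_has_integral_from_0:
  assumes "0 \<le> t"
  shows "(zdot has_integral (z t - z 0)) {0..t}"
proof -
  have "((\<lambda>s. stack (plant_field (x s) (xhs s) (w s))
      (plant_field (x s) (xhs s) (w s) - observer_field (xh s) (xhs s) (ys s)))
      has_integral stack (x t - x 0) ((x t - x 0) - (xh t - xh 0))) {0..t}"
    using assms by (intro has_integral_stack has_integral_diff plant_solution observer_solution)
  then show ?thesis
    by (simp add: zdot_def[abs_def] z_def closed_loop_field_def algebra_simps flip: stack_diff)
qed

lemma z_has_integral: "0 \<le> a \<Longrightarrow> a \<le> b \<Longrightarrow> (zdot has_integral (z b - z a)) {a..b}"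
  by (rule has_integral_subinterval_of_primitive[OF z_has_integral_from_0])

lemma z_continuous: "continuous_on {0..T} z"
proof (cases "0 \<le> T")
  case True
  have "continuous_on {0..T} (\<lambda>t. z 0 + integral {0..t} zdot)"
    using z_has_integral_from_0[OF True] by (intro continuous_intros indefinite_integral_continuous_1) blast
  moreover have "z 0 + integral {0..t} zdot = z t" if "t \<in> {0..T}" for t
    using z_has_integral_from_0[of t] that by (simp add: integral_unique)
  ultimately show ?thesis
    by (rule continuous_on_eq)
qed simp

lemma norm_x_le: "norm (x t) \<le> norm (z t)"
  and norm_xh_le: "norm (xh t) \<le> 2 * norm (z t)"
  unfolding z_def by (rule norm_le_norm_stack1, rule norm_le_twice_norm_stack_diff)

lemma z_diff: "z r - z t = stack (x r - x t) ((x r - x t) - (xh r - xh t))"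
  by (simp add: z_def algebra_simps flip: stack_diff)

lemma norm_x_diff_le: "norm (x r - x t) \<le> norm (z r - z t)"
  and norm_xh_diff_le: "norm (xh r - xh t) \<le> 2 * norm (z r - z t)"
  unfolding z_diff by (rule norm_le_norm_stack1, rule norm_le_twice_norm_stack_diff)

lemma zdot_bound:
  assumes "0 \<le> q" and window: "\<And>r. max 0 (q - \<tau>) \<le> r \<Longrightarrow> r \<le> q \<Longrightarrow> norm (z r) \<le> R"
  shows "norm (zdot q) \<le> window_growth \<sigma> * R + window_offset \<epsilon> \<omega>"
proof -
  have q_window: "max 0 (q - \<tau>) \<le> q"
    using \<open>0 \<le> q\<close> \<tau>_pos by simp
  have xh_window: "norm (xh r) \<le> 2 * R" and Cx_window: "norm (C *v x r) \<le> k * R"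
    if "max 0 (q - \<tau>) \<le> r" "r \<le> q" for r
    using norm_xh_le[of r] k_mult_le_trans[OF gains(3) order_trans[OF norm_x_le window[OF that]]]
      window[OF that]
    by simp_all
  have "norm (zdot q)
      \<le> field_lipschitz * (norm (x q) + norm (xh q) + norm (xhs q) + norm (ys q) + norm (w q))"
    using closed_loop_field_lipschitz[of "x q" "xh q" "xhs q" "ys q" "w q" 0 0 0 0 0]
    by (simp add: zdot_def closed_loop_field_zero)
  also have "\<dots> \<le> field_lipschitz * (R + 2 * R + ((1 + \<sigma>) * (2 * R) + \<epsilon>) + ((1 + \<sigma>) * (k * R) + \<epsilon>) + \<omega>)"
  proof (intro mult_left_mono add_mono field_lipschitz_nonneg)
    show "norm (x q) \<le> R" "norm (xh q) \<le> 2 * R"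
      using order_trans[OF norm_x_le window] xh_window q_window by simp_all
    show "norm (xhs q) \<le> (1 + \<sigma>) * (2 * R) + \<epsilon>"
      using estimate_held \<open>0 \<le> q\<close> less_imp_le[OF \<tau>_pos] \<sigma>_nonneg \<epsilon>_nonneg xh_window
      by (rule etm_held_norm_le)
    show "norm (ys q) \<le> (1 + \<sigma>) * (k * R) + \<epsilon>"
      using output_held \<open>0 \<le> q\<close> less_imp_le[OF \<tau>_pos] \<sigma>_nonneg \<epsilon>_nonneg Cx_window
      by (rule etm_held_norm_le)
    show "norm (w q) \<le> \<omega>"
      using w_bound \<open>0 \<le> q\<close> .
  qed
  also have "\<dots> = window_growth \<sigma> * R + window_offset \<epsilon> \<omega>"
    by (simp add: window_growth_def window_offset_def algebra_simps)
  finally show ?thesis .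
qed

lemma zdot_perturbation_le:
  assumes "0 \<le> r" and "norm (z r) \<le> R"
    and oscillation: "\<And>r'. max 0 (r - \<tau>) \<le> r' \<Longrightarrow> r' \<le> r \<Longrightarrow> norm (z r' - z r) \<le> \<tau> * M"
  shows "norm (zdot r - closed_loop_field (x r) (xh r) (xh r) (C *v x r) 0)
    \<le> field_lipschitz * ((2 + k) * (\<tau> * M + \<sigma> * R) + 2 * \<epsilon> + \<omega>)"
proof -
  have "norm (xhs r - xh r) \<le> 2 * (\<tau> * M) + \<sigma> * (2 * R) + \<epsilon>"
    using estimate_held \<open>0 \<le> r\<close> less_imp_le[OF \<tau>_pos] \<sigma>_nonneg \<epsilon>_nonneg
      order_trans[OF norm_xh_le mult_left_mono[OF \<open>norm (z r) \<le> R\<close>]]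
  proof (rule etm_held_error_le)
    show "norm (xh r' - xh r) \<le> 2 * (\<tau> * M)" if "max 0 (r - \<tau>) \<le> r'" "r' \<le> r" for r'
      using norm_xh_diff_le[of r' r] oscillation[OF that] by simp
  qed simp
  moreover have "norm (ys r - C *v x r) \<le> k * (\<tau> * M) + \<sigma> * (k * R) + \<epsilon>"
    using output_held \<open>0 \<le> r\<close> less_imp_le[OF \<tau>_pos] \<sigma>_nonneg \<epsilon>_nonneg
      k_mult_le_trans[OF gains(3) order_trans[OF norm_x_le \<open>norm (z r) \<le> R\<close>]]
  proof (rule etm_held_error_le)
    show "norm (C *v x r' - C *v x r) \<le> k * (\<tau> * M)" if "max 0 (r - \<tau>) \<le> r'" "r' \<le> r" for r'
      using k_mult_le_trans[OF gains(3) order_trans[OF norm_x_diff_le oscillation[OF that]]]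
      by (simp add: matrix_vector_mult_diff_distrib)
  qed
  moreover have "norm (zdot r - closed_loop_field (x r) (xh r) (xh r) (C *v x r) 0)
      \<le> field_lipschitz * (norm (xhs r - xh r) + norm (ys r - C *v x r) + norm (w r))"
    using closed_loop_field_lipschitz[of "x r" "xh r" "xhs r" "ys r" "w r" "x r" "xh r" "xh r" "C *v x r" 0]
    by (simp add: zdot_def)
  moreover have "norm (xhs r - xh r) + norm (ys r - C *v x r) + norm (w r)
      \<le> (2 + k) * (\<tau> * M + \<sigma> * R) + 2 * \<epsilon> + \<omega>"
    using calculation(1,2) w_bound[OF \<open>0 \<le> r\<close>] by (simp add: algebra_simps)
  ultimately show ?thesis
    by (meson order_trans mult_left_mono field_lipschitz_nonneg)
qed

lemma window_field_bound:
  assumes window: "\<And>q. max 0 (t - s - 2 * \<tau>) \<le> q \<Longrightarrow> q \<le> t \<Longrightarrow> norm (z q) \<le> R"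
    and "max 0 (t - s - \<tau>) \<le> q" and "q \<le> t"
  shows "norm (zdot q) \<le> window_growth \<sigma> * R + window_offset \<epsilon> \<omega>"
proof (rule zdot_bound)
  show "0 \<le> q"
    using assms(2) by simp
  show "norm (z r) \<le> R" if "max 0 (q - \<tau>) \<le> r" "r \<le> q" for r
    using assms(2,3) that by (intro window) auto
qed

lemma window_lipschitz:
  assumes window: "\<And>q. max 0 (t - s - 2 * \<tau>) \<le> q \<Longrightarrow> q \<le> t \<Longrightarrow> norm (z q) \<le> R"
    and "r1 \<in> {max 0 (t - s - \<tau>)..t}" and "r2 \<in> {max 0 (t - s - \<tau>)..t}"
  shows "norm (z r1 - z r2) \<le> \<bar>r1 - r2\<bar> * (window_growth \<sigma> * R + window_offset \<epsilon> \<omega>)"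
proof (rule norm_diff_le_integral_bound[OF _ _ assms(2,3)])
  show "norm (zdot q) \<le> window_growth \<sigma> * R + window_offset \<epsilon> \<omega>"
    if "max 0 (t - s - \<tau>) \<le> q" "q \<le> t" for q
    using window that by (rule window_field_bound)
  show "(zdot has_integral z b - z a) {a..b}" if "max 0 (t - s - \<tau>) \<le> a" "a \<le> b" "b \<le> t" for a b
    using that by (intro z_has_integral) auto
qed

text \<open>The increment of \<open>V\<close> over \<open>[t - s, t]\<close> depends on \<open>z\<close> over \<open>[t - s - 2\<tau>, t]\<close>: one \<open>\<tau>\<close> to bound
  the held samples entering \<open>zdot\<close>, another for the Lipschitz estimate of the sampling errors.\<close>

lemma lyapunov_rate_in_window:
  assumes window: "\<And>q. max 0 (t - s - 2 * \<tau>) \<le> q \<Longrightarrow> q \<le> t \<Longrightarrow> norm (z q) \<le> R"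
    and "s \<le> t" and "t - s \<le> r" and "r \<le> t"
  shows "zdot r \<bullet> (P *v z r) + z r \<bullet> (P *v zdot r)
    \<le> - \<alpha> * V (z r) + 2 * k * R * (sampling_gain \<tau> \<sigma> * R + sampling_offset \<tau> \<epsilon> \<omega>)"
proof -
  define M where "M = window_growth \<sigma> * R + window_offset \<epsilon> \<omega>"
  have "norm (z r) \<le> R"
    using assms(2-4) \<tau>_pos by (intro window) auto
  have "0 \<le> M"
    using window_field_bound[where t = t and s = s and R = R, OF window, of r] assms(2-4) \<tau>_pos
    by (auto simp: M_def intro: order_trans[OF norm_ge_zero])
  have "norm (zdot r - closed_loop_field (x r) (xh r) (xh r) (C *v x r) 0)
      \<le> field_lipschitz * ((2 + k) * (\<tau> * M + \<sigma> * R) + 2 * \<epsilon> + \<omega>)"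
  proof (rule zdot_perturbation_le[OF _ \<open>norm (z r) \<le> R\<close>])
    show "0 \<le> r"
      using assms(2,3) by simp
    show "norm (z r' - z r) \<le> \<tau> * M" if "max 0 (r - \<tau>) \<le> r'" "r' \<le> r" for r'
      using window_lipschitz[where t = t and s = s and R = R, OF window, of r' r] that assms(3,4)
        \<open>0 \<le> M\<close> mult_right_mono[of "\<bar>r' - r\<bar>" \<tau> M]
      by (auto simp: M_def)
  qed
  also have "\<dots> = sampling_gain \<tau> \<sigma> * R + sampling_offset \<tau> \<epsilon> \<omega>"
    by (simp add: M_def sampling_gain_def sampling_offset_def algebra_simps)
  finally have "2 * k * norm (z r) * norm (zdot r - closed_loop_field (x r) (xh r) (xh r) (C *v x r) 0)
      \<le> 2 * k * R * (sampling_gain \<tau> \<sigma> * R + sampling_offset \<tau> \<epsilon> \<omega>)"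
    using \<open>norm (z r) \<le> R\<close> k_nonneg order_trans[OF norm_ge_zero \<open>norm (z r) \<le> R\<close>]
    by (intro mult_mono mult_left_mono) auto
  then show ?thesis
    using lyapunov_derivative_le[of "x r" "xh r" "xhs r" "ys r" "w r"] by (simp add: z_def zdot_def)
qed

lemma lyapunov_increment:
  assumes "0 < s" and "s \<le> t"
    and window: "\<And>q. max 0 (t - s - 2 * \<tau>) \<le> q \<Longrightarrow> q \<le> t \<Longrightarrow> norm (z q) \<le> R"
  defines "M \<equiv> window_growth \<sigma> * R + window_offset \<epsilon> \<omega>"
  shows "V (z t) - V (z (t - s))
    \<le> s * (- \<alpha> * V (z (t - s)) + 2 * k * R * (sampling_gain \<tau> \<sigma> * R + sampling_offset \<tau> \<epsilon> \<omega>))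
      + s\<^sup>2 * (3 * k * M\<^sup>2 + 2 * \<alpha> * k * M * R)"
proof -
  have "V (z t) - V (z (t - s))
    \<le> (t - (t - s)) * (- \<alpha> * V (z (t - s)) + 2 * k * R * (sampling_gain \<tau> \<sigma> * R + sampling_offset \<tau> \<epsilon> \<omega>))
      + (t - (t - s))\<^sup>2 * (3 * k * M\<^sup>2 + 2 * \<alpha> * k * M * R)"
  proof (rule quadratic_form_increment[OF gains(11) k_nonneg less_imp_le[OF \<alpha>_pos]])
    show "(zdot has_integral z t - z (t - s)) {t - s..t}"
      using assms(1,2) by (intro z_has_integral) auto
    show "norm (zdot r) \<le> M \<and> norm (z r - z (t - s)) \<le> (r - (t - s)) * M \<and> norm (z r) \<le> R"
      if "t - s \<le> r" "r \<le> t" for r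
      using window_field_bound[where t = t and s = s and R = R, OF window, of r]
        window_lipschitz[where t = t and s = s and R = R, OF window, of r "t - s"] window[of r]
        that assms(2) \<tau>_pos
      by (auto simp: M_def)
  qed (use assms(1,2) lyapunov_rate_in_window[where t = t and s = s and R = R, OF window] in auto)
  then show ?thesis
    by simp
qed

text \<open>The coefficients of the \<open>s\<^sup>2\<close> term play no role in the Halanay argument.\<close>

lemma lyapunov_halanay_step:
  assumes small: "8 * k * sampling_gain \<tau> \<sigma> \<le> l * \<alpha> * exp (- \<alpha>)"
  obtains q1 q0 where "\<And>t s G. 0 < s \<Longrightarrow> s \<le> t \<Longrightarrow> 0 \<le> G \<Longrightarrow>
    (\<And>q. max 0 (t - s - 2 * \<tau>) \<le> q \<Longrightarrow> q \<le> t \<Longrightarrow> V (z q) \<le> G) \<Longrightarrow>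
    V (z t) - V (z (t - s))
      \<le> s * (- \<alpha> * V (z (t - s)) + \<alpha> * exp (- \<alpha>) / 2 * G + lyapunov_offset \<tau> \<epsilon> \<omega>) + s\<^sup>2 * (q1 * G + q0)"
proof
  fix t s G
  assume "0 < s" "s \<le> t" "0 \<le> G" and below: "\<And>q. max 0 (t - s - 2 * \<tau>) \<le> q \<Longrightarrow> q \<le> t \<Longrightarrow> V (z q) \<le> G"
  define R where "R = sqrt (G / l)"
  have "0 \<le> R" and G_eq: "G = l * R\<^sup>2"
    using \<open>0 \<le> G\<close> l_pos by (simp_all add: R_def)
  have "norm (z q) \<le> R" if "max 0 (t - s - 2 * \<tau>) \<le> q" "q \<le> t" for q
  proof -
    have "l * norm (z q) ^ 2 \<le> l * R\<^sup>2"
      using P_coercive[of "z q"] below[OF that] G_eq by linarith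
    then have "norm (z q) ^ 2 \<le> R\<^sup>2"
      using l_pos by simp
    then show ?thesis
      using \<open>0 \<le> R\<close> by (rule power2_le_imp_le)
  qed
  note increment = lyapunov_increment[OF \<open>0 < s\<close> \<open>s \<le> t\<close> this]
  have "2 * k * R * (sampling_gain \<tau> \<sigma> * R + sampling_offset \<tau> \<epsilon> \<omega>)
      \<le> \<alpha> * exp (- \<alpha>) / 2 * G + lyapunov_offset \<tau> \<epsilon> \<omega>"
    unfolding G_eq lyapunov_offset_def using l_pos \<alpha>_pos \<open>0 \<le> R\<close> small by (rule drift_term_bound)
  then have "s * (- \<alpha> * V (z (t - s)) + 2 * k * R * (sampling_gain \<tau> \<sigma> * R + sampling_offset \<tau> \<epsilon> \<omega>))
      \<le> s * (- \<alpha> * V (z (t - s)) + \<alpha> * exp (- \<alpha>) / 2 * G + lyapunov_offset \<tau> \<epsilon> \<omega>)"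
    using \<open>0 < s\<close> by (intro mult_left_mono) simp_all
  moreover have "3 * k * (window_growth \<sigma> * R + window_offset \<epsilon> \<omega>)\<^sup>2
      + 2 * \<alpha> * k * (window_growth \<sigma> * R + window_offset \<epsilon> \<omega>) * R
      \<le> ((2 * (3 + \<alpha>) * k * (window_growth \<sigma>)\<^sup>2 + \<alpha> * k) / l) * G
        + 2 * (3 + \<alpha>) * k * (window_offset \<epsilon> \<omega>)\<^sup>2"
    using second_order_term_bound[OF k_nonneg less_imp_le[OF \<alpha>_pos]] l_pos by (simp add: G_eq)
  then have "s\<^sup>2 * (3 * k * (window_growth \<sigma> * R + window_offset \<epsilon> \<omega>)\<^sup>2
      + 2 * \<alpha> * k * (window_growth \<sigma> * R + window_offset \<epsilon> \<omega>) * R)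
      \<le> s\<^sup>2 * (((2 * (3 + \<alpha>) * k * (window_growth \<sigma>)\<^sup>2 + \<alpha> * k) / l) * G
        + 2 * (3 + \<alpha>) * k * (window_offset \<epsilon> \<omega>)\<^sup>2)"
    by (rule mult_left_mono) simp
  ultimately show "V (z t) - V (z (t - s))
      \<le> s * (- \<alpha> * V (z (t - s)) + \<alpha> * exp (- \<alpha>) / 2 * G + lyapunov_offset \<tau> \<epsilon> \<omega>)
        + s\<^sup>2 * (((2 * (3 + \<alpha>) * k * (window_growth \<sigma>)\<^sup>2 + \<alpha> * k) / l) * G
          + 2 * (3 + \<alpha>) * k * (window_offset \<epsilon> \<omega>)\<^sup>2)"
    using increment by linarith
qed

lemma lyapunov_bound:
  assumes "\<tau> \<le> 1" and small: "8 * k * sampling_gain \<tau> \<sigma> \<le> l * \<alpha> * exp (- \<alpha>)" and "0 \<le> t"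
  shows "V (z t) \<le> k * (norm (z 0))\<^sup>2 * exp (- (\<alpha> / 2) * t) + ultimate_bound \<tau> \<epsilon> \<omega>"
proof -
  obtain q1 q0 where step: "\<And>t s G. 0 < s \<Longrightarrow> s \<le> t \<Longrightarrow> 0 \<le> G \<Longrightarrow>
    (\<And>q. max 0 (t - s - 2 * \<tau>) \<le> q \<Longrightarrow> q \<le> t \<Longrightarrow> V (z q) \<le> G) \<Longrightarrow>
    V (z t) - V (z (t - s))
      \<le> s * (- \<alpha> * V (z (t - s)) + \<alpha> * exp (- \<alpha>) / 2 * G + lyapunov_offset \<tau> \<epsilon> \<omega>) + s\<^sup>2 * (q1 * G + q0)"
    using lyapunov_halanay_step[OF small] by blast
  have "0 \<le> lyapunov_offset \<tau> \<epsilon> \<omega>"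
    using l_pos \<alpha>_pos by (simp add: lyapunov_offset_def)
  have "exp (- \<alpha>) \<le> 1"
    using \<alpha>_pos by simp
  show ?thesis
  proof (rule halanay_inequality[OF _ _ _ _ _ _ _ _ _ step \<open>0 \<le> t\<close>])
    show "continuous_on {0..T} (\<lambda>t. V (z t))" for T
      by (intro continuous_intros bounded_linear.continuous_on[OF matrix_vector_mul_bounded_linear]
          z_continuous)
    have "exp (\<alpha> / 2 * (2 * \<tau>)) \<le> exp \<alpha>"
      using \<alpha>_pos \<open>\<tau> \<le> 1\<close> by simp
    then have "\<alpha> * exp (- \<alpha>) / 2 * exp (\<alpha> / 2 * (2 * \<tau>)) \<le> \<alpha> * exp (- \<alpha>) / 2 * exp \<alpha>"
      using \<alpha>_pos by (intro mult_left_mono) auto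
    then show "\<alpha> / 2 + \<alpha> * exp (- \<alpha>) / 2 * exp (\<alpha> / 2 * (2 * \<tau>)) \<le> \<alpha>"
      by (simp add: exp_minus field_simps)
    have "\<alpha> / 2 \<le> \<alpha> - \<alpha> * exp (- \<alpha>) / 2"
      using \<alpha>_pos \<open>exp (- \<alpha>) \<le> 1\<close> by (simp add: field_simps)
    then have "\<alpha> / 2 * ultimate_bound \<tau> \<epsilon> \<omega> \<le> (\<alpha> - \<alpha> * exp (- \<alpha>) / 2) * ultimate_bound \<tau> \<epsilon> \<omega>"
      using \<alpha>_pos \<open>0 \<le> lyapunov_offset \<tau> \<epsilon> \<omega>\<close> by (intro mult_right_mono) (simp_all add: ultimate_bound_def)
    moreover have "lyapunov_offset \<tau> \<epsilon> \<omega> < \<alpha> / 2 * ultimate_bound \<tau> \<epsilon> \<omega>"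
      using \<alpha>_pos by (simp add: ultimate_bound_def field_simps)
    ultimately show "lyapunov_offset \<tau> \<epsilon> \<omega> < (\<alpha> - \<alpha> * exp (- \<alpha>) / 2) * ultimate_bound \<tau> \<epsilon> \<omega>"
      by linarith
    have "V (z 0) \<le> norm (z 0) * norm (P *v z 0)"
      by (rule order_trans[OF abs_ge_self Cauchy_Schwarz_ineq2])
    also have "\<dots> \<le> k * (norm (z 0))\<^sup>2"
      using mult_left_mono[OF gains(11)[of "z 0"] norm_ge_zero[of "z 0"]]
      by (simp add: power2_eq_square mult_ac)
    finally show "V (z 0) \<le> k * (norm (z 0))\<^sup>2 + ultimate_bound \<tau> \<epsilon> \<omega>"
      using ultimate_bound_nonneg[of \<tau> \<epsilon> \<omega>] by linarith
  qed (use \<alpha>_pos \<tau>_pos \<open>0 \<le> lyapunov_offset \<tau> \<epsilon> \<omega>\<close> k_nonneg in \<open>simp_all add: ultimate_bound_def\<close>)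
qed

lemma norm_z_bound:
  assumes "\<tau> \<le> 1" and small: "8 * k * sampling_gain \<tau> \<sigma> \<le> l * \<alpha> * exp (- \<alpha>)" and "0 \<le> t"
  shows "norm (z t) \<le> sqrt (k / l) * norm (z 0) * exp (- (\<alpha> / 4) * t) + sqrt (ultimate_bound \<tau> \<epsilon> \<omega> / l)"
proof -
  have nonneg: "0 \<le> sqrt (k / l) * norm (z 0) * exp (- (\<alpha> / 4) * t)" "0 \<le> sqrt (ultimate_bound \<tau> \<epsilon> \<omega> / l)"
    using l_pos k_nonneg ultimate_bound_nonneg[of \<tau> \<epsilon> \<omega>] by simp_all
  have "l * (norm (z t))\<^sup>2 \<le> k * (norm (z 0))\<^sup>2 * exp (- (\<alpha> / 2) * t) + ultimate_bound \<tau> \<epsilon> \<omega>"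
    using P_coercive[of "z t"] lyapunov_bound[OF assms] by simp
  then have "(norm (z t))\<^sup>2 \<le> (k * (norm (z 0))\<^sup>2 * exp (- (\<alpha> / 2) * t) + ultimate_bound \<tau> \<epsilon> \<omega>) / l"
    using l_pos by (simp add: pos_le_divide_eq mult.commute)
  also have "\<dots> = (sqrt (k / l) * norm (z 0) * exp (- (\<alpha> / 4) * t))\<^sup>2 + (sqrt (ultimate_bound \<tau> \<epsilon> \<omega> / l))\<^sup>2"
  proof -
    have "(exp (- (\<alpha> / 4) * t))\<^sup>2 = exp (- (\<alpha> / 2) * t)"
      by (simp add: power2_eq_square flip: exp_add)
    then show ?thesis
      using l_pos k_nonneg ultimate_bound_nonneg[of \<tau> \<epsilon> \<omega>]
      by (simp add: power_mult_distrib add_divide_distrib)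
  qed
  also have "\<dots> \<le> (sqrt (k / l) * norm (z 0) * exp (- (\<alpha> / 4) * t) + sqrt (ultimate_bound \<tau> \<epsilon> \<omega> / l))\<^sup>2"
    unfolding power2_sum using mult_nonneg_nonneg[OF nonneg] by linarith
  finally show ?thesis
    by (rule power2_le_imp_le) (rule add_nonneg_nonneg[OF nonneg])
qed

end

definition etm_practically_stable ::
  "real^'x^'x \<Rightarrow> real^'u^'x \<Rightarrow> real^'x^'y \<Rightarrow> real^'x^'q \<Rightarrow> real^'p^'x \<Rightarrow> real^'w^'x \<Rightarrow>
   (real^'q \<Rightarrow> real^'p) \<Rightarrow> real^'x^'u \<Rightarrow> real^'p^'u \<Rightarrow> real^'y^'q \<Rightarrow> real^'y^'x \<Rightarrow>
   real \<Rightarrow> real \<Rightarrow> real \<Rightarrow> real \<Rightarrow> real \<Rightarrow> real \<Rightarrow> real \<Rightarrow> bool"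
  where "etm_practically_stable A B C Cq E Ew p K1 K2 L1 L2 \<tau>y \<sigma>y \<epsilon>y \<tau>u \<sigma>u \<epsilon>u \<omega>0 \<longleftrightarrow>
    (\<exists>\<beta>1 \<beta>2 d. class_KL \<beta>1 \<and> class_K \<beta>2 \<and> d \<ge> 0 \<and>
      (\<forall>w x xh ty tu ys xhs.
         w \<in> borel_measurable (lebesgue_on {0..}) \<and> (\<forall>t\<ge>0. norm (w t) \<le> \<omega>0) \<and>
         etm_solution A B C Cq E Ew p K1 K2 L1 L2 \<tau>y \<sigma>y \<epsilon>y \<tau>u \<sigma>u \<epsilon>u w x xh ty tu ys xhs
         \<longrightarrow> (\<forall>t\<ge>0. norm (stack (x t) (x t - xh t))
                \<le> \<beta>1 (norm (stack (x 0) (x 0 - xh 0))) t + \<beta>2 (SUP s\<in>{0..}. norm (w s)) + d)))"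

context etm_plant
begin

lemma etm_solution_trajectory:
  assumes sol: "etm_solution A B C Cq E Ew p K1 K2 L1 L2 \<tau> \<sigma> \<epsilon> \<tau> \<sigma> \<epsilon> w x xh ty tu ys xhs"
    and "0 < \<tau>" and "0 \<le> \<sigma>" and "0 \<le> \<epsilon>" and "\<And>t. 0 \<le> t \<Longrightarrow> norm (w t) \<le> \<omega>"
  shows "etm_trajectory A B C Cq E Ew p K1 K2 L1 L2 P \<alpha> Lp l \<tau> \<sigma> \<epsilon> \<omega> x xh xhs ys w"
proof (rule etm_trajectory.intro[OF etm_plant_axioms], rule etm_trajectory_axioms.intro)
  note S = sol[unfolded etm_solution_def]
  show "0 < \<tau>" "0 \<le> \<sigma>" "0 \<le> \<epsilon>"
    by (fact assms)+
  show "norm (w t) \<le> \<omega>" if "0 \<le> t" for t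
    using assms(5) that .
  show "etm_held xh xhs \<tau> \<sigma> \<epsilon>"
    by (rule etm_held_if_event_triggered[where tk = tu]) (use S \<open>0 < \<tau>\<close> in blast)+
  show "etm_held (\<lambda>t. C *v x t) ys \<tau> \<sigma> \<epsilon>"
    by (rule etm_held_if_event_triggered[where tk = ty]) (use S \<open>0 < \<tau>\<close> in blast)+
  show "((\<lambda>s. plant_field (x s) (xhs s) (w s)) has_integral x t - x 0) {0..t}" if "0 \<le> t" for t
    using S that unfolding plant_field_def control_def by blast
  show "((\<lambda>s. observer_field (xh s) (xhs s) (ys s)) has_integral xh t - xh 0) {0..t}" if "0 \<le> t" for t
    using S that unfolding observer_field_def control_def by blast
qed

lemma etm_solution_state_bound:
  assumes "0 < \<tau>" and "\<tau> \<le> 1" and "0 \<le> \<sigma>" and "0 \<le> \<epsilon>"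
    and small: "8 * k * sampling_gain \<tau> \<sigma> \<le> l * \<alpha> * exp (- \<alpha>)"
    and "\<And>t. 0 \<le> t \<Longrightarrow> norm (w t) \<le> \<omega>"
    and "etm_solution A B C Cq E Ew p K1 K2 L1 L2 \<tau> \<sigma> \<epsilon> \<tau> \<sigma> \<epsilon> w x xh ty tu ys xhs" and "0 \<le> t"
  shows "norm (stack (x t) (x t - xh t))
    \<le> sqrt (k / l) * norm (stack (x 0) (x 0 - xh 0)) * exp (- (\<alpha> / 4) * t) + sqrt (ultimate_bound \<tau> \<epsilon> \<omega> / l)"
proof -
  interpret etm_trajectory A B C Cq E Ew p K1 K2 L1 L2 P \<alpha> Lp l \<tau> \<sigma> \<epsilon> \<omega> x xh xhs ys w
    using assms(7,1,3,4,6) by (rule etm_solution_trajectory)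
  show ?thesis
    using norm_z_bound[OF \<open>\<tau> \<le> 1\<close> small \<open>0 \<le> t\<close>] by (simp add: z_def)
qed

lemma etm_practically_stable_if_small:
  assumes "0 < \<tau>" and "\<tau> \<le> 1" and "0 \<le> \<sigma>" and "0 \<le> \<epsilon>"
    and small: "8 * k * sampling_gain \<tau> \<sigma> \<le> l * \<alpha> * exp (- \<alpha>)"
  shows "etm_practically_stable A B C Cq E Ew p K1 K2 L1 L2 \<tau> \<sigma> \<epsilon> \<tau> \<sigma> \<epsilon> \<omega>"
proof -
  define \<beta>1 where "\<beta>1 r t = sqrt (k / l) * r * exp (- (\<alpha> / 4) * t)" for r t
  define d where "d = sqrt (ultimate_bound \<tau> \<epsilon> \<omega> / l)"
  have "class_KL \<beta>1"
    unfolding \<beta>1_def using k_ge_1 l_pos \<alpha>_pos by (intro class_KL_exponential) auto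
  moreover have "0 \<le> d"
    using ultimate_bound_nonneg l_pos by (simp add: d_def)
  moreover have "norm (stack (x t) (x t - xh t))
      \<le> \<beta>1 (norm (stack (x 0) (x 0 - xh 0))) t + (SUP s\<in>{0..}. norm (w s)) + d"
    if "\<forall>t\<ge>0. norm (w t) \<le> \<omega>" and "etm_solution A B C Cq E Ew p K1 K2 L1 L2 \<tau> \<sigma> \<epsilon> \<tau> \<sigma> \<epsilon> w x xh ty tu ys xhs"
      and "0 \<le> t" for w x xh ty tu ys xhs t
  proof -
    have "0 \<le> (SUP s\<in>{0..}. norm (w s))"
      using that(1) by (intro cSUP_upper2[of _ _ 0] bdd_aboveI2[of _ _ \<omega>]) auto
    then show ?thesis
      using etm_solution_state_bound[OF assms that(1)[rule_format] that(2,3)] by (simp add: \<beta>1_def d_def)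
  qed
  ultimately show ?thesis
    unfolding etm_practically_stable_def using class_K_id by blast
qed

end

theorem theorem6:
  fixes A :: "real^'x^'x" and B :: "real^'u^'x" and C :: "real^'x^'y" and Cq :: "real^'x^'q"
    and E :: "real^'p^'x" and Ew :: "real^'w^'x" and p :: "real^'q \<Rightarrow> real^'p"
    and K1 :: "real^'x^'u" and K2 :: "real^'p^'u" and L1 :: "real^'y^'q" and L2 :: "real^'y^'x"
    and P :: "real^('x + 'x)^('x + 'x)" and \<alpha>0 \<mu> \<omega>0 :: real
  assumes p0: "p 0 = 0"
    and p_lip: "\<exists>Lp. Lp-lipschitz_on UNIV p"
    and \<omega>0_pos: "\<omega>0 > 0"
    and \<alpha>0_pos: "\<alpha>0 > 0"
    and \<mu>_pos: "\<mu> > 0"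
    and P_sym: "transpose P = P"
    and P_pos: "\<forall>z. z \<noteq> 0 \<longrightarrow> z \<bullet> (P *v z) > 0"
    and nominal: "\<forall>x xh.
      let u = K1 *v xh + K2 *v p (Cq *v xh);
          dx = A *v x + B *v u + E *v p (Cq *v x);
          dxh = A *v xh + B *v u + E *v p (Cq *v xh + L1 *v (C *v xh - C *v x))
                + L2 *v (C *v xh - C *v x);
          z = stack x (x - xh);
          dz = stack dx (dx - dxh)
      in dz \<bullet> (P *v z) + z \<bullet> (P *v dz) \<le> - \<alpha>0 * (z \<bullet> (P *v z))"
  shows "\<exists>\<tau>y \<sigma>y \<epsilon>y \<tau>u \<sigma>u \<epsilon>u.
           \<tau>y > 0 \<and> \<sigma>y > 0 \<and> \<epsilon>y > 0 \<and> \<tau>u > 0 \<and> \<sigma>u > 0 \<and> \<epsilon>u > 0 \<and>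
           (\<exists>\<beta>1 \<beta>2 d. class_KL \<beta>1 \<and> class_K \<beta>2 \<and> d \<ge> 0 \<and>
              (\<forall>w x xh ty tu ys xhs.
                 w \<in> borel_measurable (lebesgue_on {0..}) \<and> (\<forall>t\<ge>0. norm (w t) \<le> \<omega>0) \<and>
                 etm_solution A B C Cq E Ew p K1 K2 L1 L2 \<tau>y \<sigma>y \<epsilon>y \<tau>u \<sigma>u \<epsilon>u
                   w x xh ty tu ys xhs
                 \<longrightarrow> (\<forall>t\<ge>0. norm (stack (x t) (x t - xh t))
                        \<le> \<beta>1 (norm (stack (x 0) (x 0 - xh 0))) t
                          + \<beta>2 (SUP s\<in>{0..}. norm (w s)) + d)))"
proof -
  obtain Lp where "Lp-lipschitz_on UNIV p"
    using p_lip by blast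
  obtain l where "0 < l" and "\<And>z. l * norm z ^ 2 \<le> z \<bullet> (P *v z)"
    using quadratic_form_coercive[OF P_pos] by blast
  interpret etm_plant A B C Cq E Ew p K1 K2 L1 L2 P \<alpha>0 Lp l
    by (rule etm_plant.intro) (fact p0 \<open>Lp-lipschitz_on UNIV p\<close> \<open>0 < l\<close> \<alpha>0_pos nominal | fact)+
  obtain \<theta> where \<theta>: "0 < \<theta>" "\<theta> \<le> 1" "8 * k * sampling_gain \<theta> \<theta> \<le> l * \<alpha>0 * exp (- \<alpha>0)"
    by (rule small_sampling_parameter)
  have stable: "etm_practically_stable A B C Cq E Ew p K1 K2 L1 L2 \<theta> \<theta> 1 \<theta> \<theta> 1 \<omega>0"
    using \<theta> by (intro etm_practically_stable_if_small) auto
  show ?thesis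
    by (rule exI[of _ \<theta>], rule exI[of _ \<theta>], rule exI[of _ 1], rule exI[of _ \<theta>], rule exI[of _ \<theta>],
        rule exI[of _ 1]) (use stable \<theta>(1) in \<open>simp add: etm_practically_stable_def\<close>)
qed

end
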